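(* Let $p$ be a prime number and let $\gamma\in\lambda(\mathrm{SL}_2(\mathbb{Z}))$ be a torsion class (the conjugacy class of an element of finite order). Then $T_p=\mathrm{id}+\mathbf{e}_p$ on torsion classes, i.e. $T_p(\gamma)=\gamma+\mathbf{e}_p(\gamma)$, and $$T_p(\gamma)=\begin{cases}(p+1)\gamma&\gamma=\pm\mathrm{id},\ \text{for all }p\\ \gamma^2+\gamma&|\gamma|=4\text{ and }p=2\\ 2\gamma+\tfrac{p-1}{2}\gamma^2&|\gamma|=4\text{ and }p\equiv1\bmod4\\ \tfrac{p+1}{2}\gamma^2&|\gamma|=4\text{ and }p\equiv3\bmod4\\ \gamma+\gamma^3&|\gamma|=3,6\text{ and }p=3\\ 2\gamma+\tfrac{p-1}{3}\gamma^3&|\gamma|=3,6\text{ and }p\equiv1\bmod3\\ \tfrac{p+1}{3}\gamma^3&|\gamma|=3,6\text{ and }p\equiv-1\bmod3.\end{cases}$$ Here $|\gamma|$ is the order of $\gamma$ and $\gamma^k$ is the conjugacy class of the $k$th power of a representative of $\gamma$.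
   Context: For a group $\Gamma$, $\lambda(\Gamma)$ is its set of conjugacy classes and $\mathbb{Z}\lambda(\Gamma)$ the free abelian group on it. A homomorphism $\psi$ induces $\psi_*$ on $\mathbb{Z}\lambda$. For a finite index subgroup $\pi:\Gamma'\hookrightarrow\Gamma$, the pullback $\pi^*:\mathbb{Z}\lambda(\Gamma)\to\mathbb{Z}\lambda(\Gamma')$ takes $[\alpha]$ to $\sum_{s\in\Gamma'\backslash\Gamma/\langle\alpha\rangle}[\gamma_s\alpha^{d_s}\gamma_s^{-1}]$, with $\gamma_s$ representing $s$ and $d_s=\min\{k>0:\gamma_s\alpha^k\gamma_s^{-1}\in\Gamma'\}$. Let $\pi:\Gamma_0(p)\hookrightarrow\mathrm{SL}_2(\mathbb{Z})$ be the inclusion of the subgroup of matrices upper triangular mod $p$. On $\mathbb{Z}\lambda(\mathrm{SL}_2(\mathbb{Z}))$, $\mathbf{e}_p=\pi_*\pi^*-\mathrm{id}$ and $T_p=\pi^{op}_*\circ\pi^*$, where $\pi^{op}:\Gamma_0(p)\to\mathrm{SL}_2(\mathbb{Z})$, $\gamma\mapsto g_p\gamma g_p^{-1}$, $g_p=\mathrm{diag}(p,1)$. *)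

theory Defs
  imports
    "HOL-Algebra.Free_Abelian_Groups"
    "HOL-Algebra.Generated_Groups"
    "HOL-Algebra.Multiplicative_Group"
    "HOL-Analysis.Determinants"
    "HOL-Number_Theory.Cong"
begin

section \<open>Conjugacy classes and the free abelian group on them\<close>

definition conj_class :: "('a, 'm) monoid_scheme \<Rightarrow> 'a \<Rightarrow> 'a set" where
  "conj_class G a = {g \<otimes>\<^bsub>G\<^esub> a \<otimes>\<^bsub>G\<^esub> inv\<^bsub>G\<^esub> g | g. g \<in> carrier G}"

definition conj_classes :: "('a, 'm) monoid_scheme \<Rightarrow> 'a set set" where
  "conj_classes G = conj_class G ` carrier G"

text \<open>
  Functions of a conjugacy class are given by a formula in a representative; every such
  formula below is independent of the choice when \<open>G\<close> is a group and \<open>\<psi>\<close> a homomorphism.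
\<close>
definition class_rep :: "'a set \<Rightarrow> 'a" where
  "class_rep c = (SOME a. a \<in> c)"

definition class_pow :: "('a, 'm) monoid_scheme \<Rightarrow> 'a set \<Rightarrow> nat \<Rightarrow> 'a set" where
  "class_pow G c k = conj_class G (class_rep c [^]\<^bsub>G\<^esub> k)"

definition class_ord :: "('a, 'm) monoid_scheme \<Rightarrow> 'a set \<Rightarrow> nat" where
  "class_ord G c = group.ord G (class_rep c)"

definition torsion_classes :: "('a, 'm) monoid_scheme \<Rightarrow> 'a set set" where
  "torsion_classes G =
     {conj_class G a | a. a \<in> carrier G \<and> (\<exists>n::nat. n > 0 \<and> a [^]\<^bsub>G\<^esub> n = \<one>\<^bsub>G\<^esub>)}"

text \<open>
  The free abelian group on \<open>conj_classes G\<close> is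
  \<^term>\<open>free_Abelian_group (conj_classes G)\<close>, whose elements are the finitely supported
  functions \<^typ>\<open>'a set \<Rightarrow>\<^sub>0 int\<close> with support in \<open>conj_classes G\<close>.
  Homomorphisms between such groups are written as additive maps on the whole type.
\<close>
definition pushforward ::
  "('b, 'n) monoid_scheme \<Rightarrow> ('a \<Rightarrow> 'b) \<Rightarrow> ('a set \<Rightarrow>\<^sub>0 int) \<Rightarrow> ('b set \<Rightarrow>\<^sub>0 int)" where
  "pushforward H \<psi> = frag_extend (\<lambda>c. frag_of (conj_class H (\<psi> (class_rep c))))"

text \<open>The double cosets \<open>H \ G / \<langle>a\<rangle>\<close>.\<close>
definition double_cosets :: "('a, 'm) monoid_scheme \<Rightarrow> 'a set \<Rightarrow> 'a \<Rightarrow> 'a set set" where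
  "double_cosets G H a = {(H #>\<^bsub>G\<^esub> g) <#>\<^bsub>G\<^esub> generate G {a} | g. g \<in> carrier G}"

definition return_time :: "('a, 'm) monoid_scheme \<Rightarrow> 'a set \<Rightarrow> 'a \<Rightarrow> 'a \<Rightarrow> nat" where
  "return_time G H a g =
     (LEAST k::nat. k > 0 \<and> g \<otimes>\<^bsub>G\<^esub> (a [^]\<^bsub>G\<^esub> k) \<otimes>\<^bsub>G\<^esub> inv\<^bsub>G\<^esub> g \<in> H)"

text \<open>
  The pullback along the inclusion of a subgroup \<open>H\<close>; meaningful only for \<open>H\<close> of finite index.
  The classes on the right-hand side are classes of \<open>H\<close>, not of \<open>G\<close>.
\<close>
definition pullback ::
  "('a, 'm) monoid_scheme \<Rightarrow> 'a set \<Rightarrow> ('a set \<Rightarrow>\<^sub>0 int) \<Rightarrow> ('a set \<Rightarrow>\<^sub>0 int)" where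
  "pullback G H = frag_extend (\<lambda>c.
     let a = class_rep c in
     \<Sum>s \<in> double_cosets G H a.
       let g = (SOME g. g \<in> s) in
       frag_of (conj_class (G\<lparr>carrier := H\<rparr>)
         (g \<otimes>\<^bsub>G\<^esub> (a [^]\<^bsub>G\<^esub> return_time G H a g) \<otimes>\<^bsub>G\<^esub> inv\<^bsub>G\<^esub> g)))"


section \<open>Hecke operators on conjugacy classes of the modular group\<close>

definition SL2Z :: "(int^2^2) monoid" where
  "SL2Z = \<lparr>carrier = {A. det A = 1}, monoid.mult = (**), one = mat 1\<rparr>"

definition Gamma0 :: "nat \<Rightarrow> (int^2^2) set" where
  "Gamma0 p = {A \<in> carrier SL2Z. int p dvd A $ 2 $ 1}"

definition g_mat :: "nat \<Rightarrow> rat^2^2" where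
  "g_mat p = vector [vector [of_nat p, 0], vector [0, 1]]"

text \<open>
  On \<open>Gamma0 p\<close> the conjugate by \<open>g_mat p\<close>, formed over the rationals, has integer entries;
  \<open>pi_op\<close> is that integer matrix.
\<close>
definition pi_op :: "nat \<Rightarrow> int^2^2 \<Rightarrow> int^2^2" where
  "pi_op p A = (THE B. map_matrix of_int B = g_mat p ** map_matrix of_int A ** matrix_inv (g_mat p))"

definition hecke_e :: "nat \<Rightarrow> ((int^2^2) set \<Rightarrow>\<^sub>0 int) \<Rightarrow> ((int^2^2) set \<Rightarrow>\<^sub>0 int)" where
  "hecke_e p x = pushforward SL2Z (\<lambda>A. A) (pullback SL2Z (Gamma0 p) x) - x"

definition hecke_T :: "nat \<Rightarrow> ((int^2^2) set \<Rightarrow>\<^sub>0 int) \<Rightarrow> ((int^2^2) set \<Rightarrow>\<^sub>0 int)" where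
  "hecke_T p x = pushforward SL2Z (pi_op p) (pullback SL2Z (Gamma0 p) x)"

end

theory Submission
  imports Defs "HOL-Number_Theory.Residue_Primitive_Roots"
begin

text \<open>
  Let \<open>a\<close> represent \<open>\<gamma>\<close>. Each double coset \<open>s\<close> of \<open>\<Gamma>\<^sub>0(p)\<close> and \<open>\<langle>a\<rangle>\<close> contributes the class of \<open>a\<^sup>d\<close> to
  \<open>\<pi>\<^sub>*\<pi>\<^sup>*\<gamma>\<close>, where \<open>d\<close>, the return time, is the number of right cosets of \<open>\<Gamma>\<^sub>0(p)\<close> inside \<open>s\<close>. If
  \<open>a\<^sup>m = \<plusminus>1\<close> with \<open>m\<close> prime, then \<open>d\<close> is \<open>1\<close> or \<open>m\<close>, so the sum is \<open>F \<gamma> + N \<gamma>\<^sup>m\<close> with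
  \<open>F + m N = p + 1\<close>, where \<open>F\<close> is the number of fixed points of \<open>a\<close> on the projective line over
  \<open>F\<^sub>p\<close>. A torsion element other than \<open>\<plusminus>1\<close> has trace \<open>t\<close> in \<open>{0, 1, -1}\<close>, and its class is determined by
  \<open>t\<close> and the sign \<open>s\<close> of its lower left entry. Hence \<open>F\<close> is the number of roots of
  \<open>X\<^sup>2 - s t X + 1\<close> modulo \<open>p\<close>. Conjugation by \<open>g\<^sub>p\<close> preserves the trace and that sign, so on torsion
  classes \<open>\<pi>\<^sup>o\<^sup>p\<close> induces the same map as \<open>\<pi>\<close>, which gives \<open>T\<^sub>p = id + e\<^sub>p\<close>.
\<close>

section \<open>Double cosets of a torsion element\<close>

lemma (in group) conj_nat_pow:
  assumes "a \<in> carrier G" "g \<in> carrier G"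
  shows "g \<otimes> a [^] (k::nat) \<otimes> inv g = (g \<otimes> a \<otimes> inv g) [^] k"
proof (induction k)
  case (Suc k)
  have "g \<otimes> a [^] Suc k \<otimes> inv g = (g \<otimes> a [^] k \<otimes> inv g) \<otimes> (g \<otimes> a \<otimes> inv g)"
    using assms by (simp add: m_assoc inv_solve_left)
  with Suc show ?case by simp
qed (use assms in simp)

text \<open>Division with remainder: the exponents that carry \<open>a\<close> into \<open>H\<close>
  after conjugation by \<open>g\<close> are closed under remainders modulo the least positive one.
  Torsion of \<open>a\<close> supplies a positive one, so the \<open>LEAST\<close> in
  \<open>return_time\<close> is attained.\<close>

lemma (in group) return_time_dvd_iff:
  assumes H: "subgroup H G" and a: "a \<in> carrier G" and g: "g \<in> carrier G"
    and tor: "0 < n" "a [^] (n::nat) = \<one>"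
  shows return_time_pos: "0 < return_time G H a g"
    and return_time_in: "g \<otimes> a [^] return_time G H a g \<otimes> inv g \<in> H"
    and "g \<otimes> a [^] k \<otimes> inv g \<in> H \<longleftrightarrow> return_time G H a g dvd k"
proof -
  let ?P = "\<lambda>k::nat. g \<otimes> a [^] k \<otimes> inv g \<in> H"
  let ?d = "return_time G H a g"
  interpret H: subgroup H G by fact
  have "0 < n \<and> ?P n" using tor g by simp
  then have *: "0 < ?d \<and> ?P ?d" unfolding return_time_def by (rule LeastI)
  then show "0 < ?d" "?P ?d" by auto
  note conj_pow = conj_nat_pow [OF a g]
  define b where "b = g \<otimes> a \<otimes> inv g"
  have b: "b \<in> carrier G" using a g by (simp add: b_def)
  have bd: "b [^] ?d \<in> H" using * conj_pow b_def by simp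
  have bdq: "b [^] (?d * q) \<in> H" for q
  proof (induction q)
    case (Suc q)
    then show ?case using bd b by (simp add: nat_pow_mult [symmetric])
  qed simp
  have "?P k \<longleftrightarrow> ?d dvd k"
  proof
    assume "?P k"
    then have k: "b [^] k \<in> H" using conj_pow b_def by simp
    have "b [^] k = b [^] (?d * (k div ?d)) \<otimes> b [^] (k mod ?d)"
      using b by (simp add: nat_pow_mult)
    then have "b [^] (k mod ?d) = inv (b [^] (?d * (k div ?d))) \<otimes> b [^] k"
      using b by (simp add: inv_solve_left)
    then have "b [^] (k mod ?d) \<in> H" using k bdq by simp
    then have "?P (k mod ?d)" using conj_pow b_def by simp
    moreover have "k mod ?d < ?d" using * by simp
    ultimately have "\<not> 0 < k mod ?d"
      using not_less_Least [of "k mod ?d" "\<lambda>k. k > 0 \<and> ?P k"] unfolding return_time_def by auto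
    then show "?d dvd k" by auto
  next
    assume "?d dvd k"
    then show "?P k" using bdq conj_pow b_def by auto
  qed
  then show "g \<otimes> a [^] k \<otimes> inv g \<in> H \<longleftrightarrow> return_time G H a g dvd k" .
qed

lemma (in group) r_coset_eq_iff:
  assumes "subgroup H G" "x \<in> carrier G" "y \<in> carrier G"
  shows "H #> x = H #> y \<longleftrightarrow> x \<otimes> inv y \<in> H"
  using assms subgroup.rcos_module [OF assms(1) is_group assms(3,2)]
    repr_independence [OF _ assms(3,1)] rcos_self [OF assms(2,1)] by auto

text \<open>As \<open>a\<close> has finite order, its natural powers exhaust the group it generates.
  A double coset is thus the union of an orbit of right cosets under right multiplication by
  \<open>a\<close>.\<close>

lemma (in group) double_coset_eq_UN:
  assumes "subgroup H G" and a: "a \<in> carrier G" and g: "g \<in> carrier G"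
    and tor: "0 < n" "a [^] (n::nat) = \<one>"
  shows "(H #> g) <#> generate G {a} = (\<Union>k::nat. H #> (g \<otimes> a [^] k))"
proof -
  have "H \<subseteq> carrier G" using assms(1) subgroup.subset by blast
  then have assoc: "h \<otimes> g \<otimes> a [^] k = h \<otimes> (g \<otimes> a [^] k)" if "h \<in> H" for h and k :: nat
    using that a g by (auto simp: m_assoc)
  have "ord a \<noteq> 0" using ord_eq_0 [OF a] tor by auto
  then have L: "x \<in> (H #> g) <#> generate G {a} \<longleftrightarrow> (\<exists>h\<in>H. \<exists>k::nat. x = h \<otimes> g \<otimes> a [^] k)" for x
    using a by (auto simp: generate_pow_nat set_mult_def r_coset_def)
  have R: "x \<in> (\<Union>k::nat. H #> (g \<otimes> a [^] k)) \<longleftrightarrow>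
      (\<exists>h\<in>H. \<exists>k::nat. x = h \<otimes> (g \<otimes> a [^] k))" for x
    by (auto simp: r_coset_def)
  show ?thesis by (rule Set.set_eqI) (simp only: L R assoc cong: bex_cong)
qed

text \<open>Every element of a double coset can serve as its representative. This makes the choice
  by \<open>SOME\<close> in \<open>pullback\<close> harmless.\<close>

lemma (in group) double_coset_rep:
  assumes H: "subgroup H G" and a: "a \<in> carrier G"
    and tor: "0 < n" "a [^] (n::nat) = \<one>"
    and s: "s \<in> double_cosets G H a" and g: "g \<in> s"
  shows "g \<in> carrier G" and "s = (\<Union>k::nat. H #> (g \<otimes> a [^] k))"
proof -
  obtain x where x: "x \<in> carrier G" and sx: "s = (\<Union>k::nat. H #> (x \<otimes> a [^] k))"
    using s double_coset_eq_UN [OF H a _ tor] unfolding double_cosets_def by auto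
  then obtain i where i: "g \<in> H #> (x \<otimes> a [^] (i::nat))" using g by auto
  have HG: "H \<subseteq> carrier G" using H subgroup.subset by blast
  show gG: "g \<in> carrier G" using i x a r_coset_subset_G [OF HG, of "x \<otimes> a [^] i"] by auto
  have Hg: "H #> g = H #> (x \<otimes> a [^] i)" using repr_independence [OF i _ H] x a by simp
  have shift: "H #> (g \<otimes> a [^] k) = H #> (x \<otimes> a [^] (i + k))" for k :: nat
  proof -
    have "H #> (g \<otimes> a [^] k) = (H #> g) #> a [^] k"
      using HG gG a by (simp add: coset_mult_assoc)
    also have "\<dots> = H #> (x \<otimes> a [^] (i + k))"
      using HG a x by (simp add: Hg coset_mult_assoc m_assoc nat_pow_mult)
    finally show ?thesis .
  qed
  \<comment> \<open>Going back from \<open>x\<close> to \<open>g\<close> needs the exponent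
    \<open>k - i\<close>; adding the multiple \<open>n * i\<close> of the period keeps it
    natural.\<close>
  have unshift: "H #> (x \<otimes> a [^] k) = H #> (g \<otimes> a [^] (n * i + k - i))" for k :: nat
  proof -
    have "i + (n * i + k - i) = n * i + k" using tor(1) by (cases n) auto
    moreover have "a [^] (n * i + k) = a [^] k"
      using tor a by (simp add: nat_pow_mult [symmetric] nat_pow_pow [symmetric])
    ultimately show ?thesis using shift by simp
  qed
  show "s = (\<Union>k::nat. H #> (g \<otimes> a [^] k))"
    unfolding sx using shift unshift by blast
qed

text \<open>The right cosets inside \<open>s\<close> form one orbit of \<open>a\<close>, and the
  return time is the period of that orbit.\<close>

lemma (in group) card_rcosets_in_double_coset:
  assumes H: "subgroup H G" and a: "a \<in> carrier G"
    and tor: "0 < n" "a [^] (n::nat) = \<one>"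
    and s: "s \<in> double_cosets G H a" and g: "g \<in> s"
  shows "card {c \<in> rcosets H. c \<subseteq> s} = return_time G H a g"
proof -
  let ?d = "return_time G H a g"
  note gG = double_coset_rep(1) [OF assms] and s_eq = double_coset_rep(2) [OF assms]
  have HG: "H \<subseteq> carrier G" using H subgroup.subset by blast
  note rt = return_time_dvd_iff [OF H a gG tor]
  define f where "f = (\<lambda>k::nat. H #> (g \<otimes> a [^] k))"
  have f_eq: "f (i + k) = f i \<longleftrightarrow> ?d dvd k" for i k
  proof -
    have "f (i + k) = f i \<longleftrightarrow> g \<otimes> a [^] (i + k) \<otimes> inv (g \<otimes> a [^] i) \<in> H"
      unfolding f_def using r_coset_eq_iff [OF H] a gG by simp
    also have "g \<otimes> a [^] (i + k) \<otimes> inv (g \<otimes> a [^] i) = g \<otimes> a [^] k \<otimes> inv g"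
    proof -
      have "g \<otimes> a [^] (i + k) = g \<otimes> a [^] k \<otimes> a [^] i"
        using a gG by (simp add: m_assoc nat_pow_mult add.commute)
      moreover have "a [^] i \<otimes> (inv (a [^] i) \<otimes> inv g) = inv g"
        using a gG by (simp add: m_assoc [symmetric])
      ultimately show ?thesis using a gG by (simp add: m_assoc inv_mult_group)
    qed
    finally show ?thesis using rt(3) by simp
  qed
  have "inj_on f {..<?d}"
  proof (rule linorder_inj_onI)
    fix i j assume "i < j" "i \<in> {..<?d}" "j \<in> {..<?d}"
    then show "f i \<noteq> f j" using f_eq [of i "j - i"] by (auto dest: dvd_imp_le)
  qed auto
  moreover have "{c \<in> rcosets H. c \<subseteq> s} = f ` {..<?d}"
  proof
    show "f ` {..<?d} \<subseteq> {c \<in> rcosets H. c \<subseteq> s}"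
      using s_eq a gG HG by (auto simp: f_def intro!: rcosetsI)
    show "{c \<in> rcosets H. c \<subseteq> s} \<subseteq> f ` {..<?d}"
    proof
      fix c assume c: "c \<in> {c \<in> rcosets H. c \<subseteq> s}"
      then obtain x where x: "x \<in> carrier G" "c = H #> x" unfolding RCOSETS_def by auto
      then have "x \<in> s" using c rcos_self [OF _ H] by blast
      then obtain k where "x \<in> f k" using s_eq f_def by auto
      then have "c = f k" using repr_independence [OF _ _ H] x a gG unfolding f_def by simp
      moreover have "f k = f (k mod ?d)"
        using f_eq [of "k mod ?d" "?d * (k div ?d)"] by simp
      moreover have "k mod ?d \<in> {..<?d}" using rt(1) by simp
      ultimately show "c \<in> f ` {..<?d}" by blast
    qed
  qed
  ultimately show ?thesis by (simp add: card_image)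
qed

text \<open>The double cosets partition the right cosets of \<open>H\<close>, so the orbit lengths
  add up to the index.\<close>

lemma (in group) sum_return_time:
  assumes H: "subgroup H G" and a: "a \<in> carrier G"
    and tor: "0 < n" "a [^] (n::nat) = \<one>" and fin: "finite (rcosets H)"
    and r: "\<And>s. s \<in> double_cosets G H a \<Longrightarrow> r s \<in> s"
  shows "finite (double_cosets G H a)"
    and "(\<Sum>s\<in>double_cosets G H a. return_time G H a (r s)) = card (rcosets H)"
proof -
  let ?D = "double_cosets G H a"
  have HG: "H \<subseteq> carrier G" using H subgroup.subset by blast
  have "?D = (\<lambda>c. c <#> generate G {a}) ` (rcosets H)"
    unfolding double_cosets_def RCOSETS_def by auto
  then show finD: "finite ?D" using fin by simp
  have "card (\<Union>s\<in>?D. {c \<in> rcosets H. c \<subseteq> s}) = (\<Sum>s\<in>?D. card {c \<in> rcosets H. c \<subseteq> s})"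
  proof (rule card_UN_disjoint [OF finD])
    show "\<forall>s\<in>?D. finite {c \<in> rcosets H. c \<subseteq> s}" using fin by simp
    show "\<forall>s\<in>?D. \<forall>t\<in>?D. s \<noteq> t \<longrightarrow>
        {c \<in> rcosets H. c \<subseteq> s} \<inter> {c \<in> rcosets H. c \<subseteq> t} = {}"
    proof (intro ballI impI)
      fix s t assume st: "s \<in> ?D" "t \<in> ?D" "s \<noteq> t"
      \<comment> \<open>A common element would rebuild both \<open>s\<close> and \<open>t\<close> as
        the same union.\<close>
      have "x \<notin> t" if "x \<in> s" for x
        using double_coset_rep(2) [OF H a tor] st that by metis
      moreover have "\<exists>x. x \<in> c" if "c \<in> rcosets H" for c
        using subgroup.rcosets_non_empty [OF H that] by auto
      ultimately show "{c \<in> rcosets H. c \<subseteq> s} \<inter> {c \<in> rcosets H. c \<subseteq> t} = {}" by blast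
    qed
  qed
  also have "(\<Union>s\<in>?D. {c \<in> rcosets H. c \<subseteq> s}) = rcosets H"
  proof -
    have "\<exists>s\<in>?D. c \<subseteq> s" if c: "c \<in> rcosets H" for c
    proof -
      obtain x where x: "x \<in> carrier G" "c = H #> x" using c unfolding RCOSETS_def by auto
      have "H #> (x \<otimes> a [^] (0::nat)) \<subseteq> (\<Union>k::nat. H #> (x \<otimes> a [^] k))" by blast
      then have "c \<subseteq> (H #> x) <#> generate G {a}"
        unfolding double_coset_eq_UN [OF H a x(1) tor] using x by simp
      then show ?thesis using x unfolding double_cosets_def by blast
    qed
    then show ?thesis by blast
  qed
  also have "(\<Sum>s\<in>?D. card {c \<in> rcosets H. c \<subseteq> s}) = (\<Sum>s\<in>?D. return_time G H a (r s))"
    using card_rcosets_in_double_coset [OF H a tor] r by (intro sum.cong) auto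
  finally show "(\<Sum>s\<in>?D. return_time G H a (r s)) = card (rcosets H)" by simp
qed

section \<open>Fixed right cosets and the sum over double cosets\<close>

definition fixed_rcosets :: "('a, 'm) monoid_scheme \<Rightarrow> 'a set \<Rightarrow> 'a \<Rightarrow> 'a set set" where
  "fixed_rcosets G H a = {c \<in> rcosets\<^bsub>G\<^esub> H. c #>\<^bsub>G\<^esub> a = c}"

lemma (in group) r_coset_fixed_iff:
  assumes H: "subgroup H G" and a: "a \<in> carrier G" and g: "g \<in> carrier G"
  shows "(H #> g) #> a = H #> g \<longleftrightarrow> g \<otimes> a \<otimes> inv g \<in> H"
  using coset_mult_assoc [OF subgroup.subset [OF H] g a]
    r_coset_eq_iff [OF H, of "g \<otimes> a" g] a g by simp

text \<open>An orbit of length one is a single right coset, so these double cosets are literally the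
  fixed right cosets.\<close>

lemma (in group) return_time_1_double_cosets:
  assumes H: "subgroup H G" and a: "a \<in> carrier G"
    and tor: "0 < n" "a [^] (n::nat) = \<one>"
    and r: "\<And>s. s \<in> double_cosets G H a \<Longrightarrow> r s \<in> s"
  shows "{s \<in> double_cosets G H a. return_time G H a (r s) = 1} = fixed_rcosets G H a"
proof -
  have HG: "H \<subseteq> carrier G" using H subgroup.subset by blast
  have rt1: "return_time G H a g = 1 \<longleftrightarrow> g \<otimes> a \<otimes> inv g \<in> H" if "g \<in> carrier G" for g
    using return_time_dvd_iff(3) [OF H a that tor, of 1] a by simp
  \<comment> \<open>If \<open>a\<close> fixes the right coset of \<open>g\<close>, so do its powers,
    and the double coset collapses to that right coset.\<close>
  have absorb: "(\<Union>k::nat. H #> (g \<otimes> a [^] k)) = H #> g"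
    if g: "g \<in> carrier G" and fx: "g \<otimes> a \<otimes> inv g \<in> H" for g
  proof -
    have "H #> (g \<otimes> a [^] k) = H #> g" for k :: nat
    proof (induction k)
      case (Suc k)
      have "H #> (g \<otimes> a [^] Suc k) = (H #> (g \<otimes> a [^] k)) #> a"
        using HG a g by (simp add: coset_mult_assoc m_assoc)
      then show ?case using Suc r_coset_fixed_iff [OF H a g] fx by simp
    qed (use g in simp)
    then show ?thesis by simp
  qed
  show ?thesis
  proof (intro equalityI subsetI)
    fix s assume s: "s \<in> {s \<in> double_cosets G H a. return_time G H a (r s) = 1}"
    note rep = double_coset_rep [OF H a tor, of s "r s"]
    have g: "r s \<in> carrier G" using rep s r by simp
    have fx: "r s \<otimes> a \<otimes> inv (r s) \<in> H" using rt1 [OF g] s by simp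
    have "s = H #> r s" using rep(2) s r absorb [OF g fx] by simp
    then show "s \<in> fixed_rcosets G H a"
      using r_coset_fixed_iff [OF H a g] fx rcosetsI [OF HG g] by (simp add: fixed_rcosets_def)
  next
    fix c assume c: "c \<in> fixed_rcosets G H a"
    then obtain x where x: "x \<in> carrier G" "c = H #> x"
      unfolding fixed_rcosets_def RCOSETS_def by auto
    have fx: "x \<otimes> a \<otimes> inv x \<in> H"
      using c x r_coset_fixed_iff [OF H a x(1)] by (simp add: fixed_rcosets_def)
    have "(H #> x) <#> generate G {a} = c"
      using double_coset_eq_UN [OF H a x(1) tor] absorb [OF x(1) fx] x by simp
    then have cD: "c \<in> double_cosets G H a" using x unfolding double_cosets_def by blast
    have g: "r c \<in> carrier G" using double_coset_rep(1) [OF H a tor cD r [OF cD]] .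
    have "c = H #> r c" using repr_independence [OF _ x(1) H] r [OF cD] x by simp
    then have "r c \<otimes> a \<otimes> inv (r c) \<in> H"
      using c r_coset_fixed_iff [OF H a g] by (simp add: fixed_rcosets_def)
    then show "c \<in> {s \<in> double_cosets G H a. return_time G H a (r s) = 1}"
      using rt1 [OF g] cD by simp
  qed
qed

text \<open>Right multiplication by \<open>h\<close> carries the fixed points of the conjugate to
  those of \<open>a\<close>. Fixed points may therefore be counted on any convenient member of a
  conjugacy class.\<close>

lemma (in group) card_fixed_rcosets_conj:
  assumes H: "subgroup H G" and a: "a \<in> carrier G" and h: "h \<in> carrier G"
  shows "card (fixed_rcosets G H (h \<otimes> a \<otimes> inv h)) = card (fixed_rcosets G H a)"
proof (rule bij_betw_same_card)
  have HG: "H \<subseteq> carrier G" using H subgroup.subset by blast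
  have cG: "c \<subseteq> carrier G" if "c \<in> rcosets H" for c
    using subgroup.rcosets_carrier [OF H is_group that] .
  have shift: "c #> x \<in> rcosets H" if "c \<in> rcosets H" "x \<in> carrier G" for c x
    using that HG unfolding RCOSETS_def by (auto simp: coset_mult_assoc)
  show "bij_betw (\<lambda>c. c #> h) (fixed_rcosets G H (h \<otimes> a \<otimes> inv h)) (fixed_rcosets G H a)"
  proof (rule bij_betw_byWitness [where f' = "\<lambda>c. c #> inv h"])
    show "\<forall>c\<in>fixed_rcosets G H (h \<otimes> a \<otimes> inv h). c #> h #> inv h = c"
      using h cG by (auto simp: fixed_rcosets_def coset_mult_assoc)
    show "\<forall>c\<in>fixed_rcosets G H a. c #> inv h #> h = c"
      using h cG by (auto simp: fixed_rcosets_def coset_mult_assoc)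
    show "(\<lambda>c. c #> h) ` fixed_rcosets G H (h \<otimes> a \<otimes> inv h) \<subseteq> fixed_rcosets G H a"
    proof (clarsimp simp: fixed_rcosets_def shift h)
      fix c assume c: "c \<in> rcosets H" "c #> (h \<otimes> a \<otimes> inv h) = c"
      have "c #> h #> a = c #> (h \<otimes> a \<otimes> inv h) #> h"
        using cG [OF c(1)] a h by (simp add: coset_mult_assoc m_assoc)
      then show "c #> h #> a = c #> h" using c by simp
    qed
    show "(\<lambda>c. c #> inv h) ` fixed_rcosets G H a \<subseteq> fixed_rcosets G H (h \<otimes> a \<otimes> inv h)"
    proof (clarsimp simp: fixed_rcosets_def shift h)
      fix c assume c: "c \<in> rcosets H" "c #> a = c"
      have "c #> inv h #> (h \<otimes> a \<otimes> inv h) = c #> a #> inv h"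
        using cG [OF c(1)] a h by (simp add: coset_mult_assoc m_assoc [symmetric])
      then show "c #> inv h #> (h \<otimes> a \<otimes> inv h) = c #> inv h" using c by simp
    qed
  qed
qed

lemma sum_const_frag: "(\<Sum>x\<in>A. c) = frag_cmul (int (card A)) c"
  by (induction A rule: infinite_finite_induct) (simp_all add: frag_cmul_distrib)

text \<open>Every return time divides the prime \<open>m\<close>, hence is \<open>1\<close> or
  \<open>m\<close>. Here \<open>N\<close> is the number of double cosets with return time
  \<open>m\<close>; the index equation recovers it from the number of fixed points.\<close>

lemma (in group) sum_double_cosets:
  fixes m :: nat and f :: "nat \<Rightarrow> 'c \<Rightarrow>\<^sub>0 int"
  assumes H: "subgroup H G" and a: "a \<in> carrier G"
    and tor: "0 < n" "a [^] (n::nat) = \<one>" and fin: "finite (rcosets H)"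
    and r: "\<And>s. s \<in> double_cosets G H a \<Longrightarrow> r s \<in> s"
    and m: "prime m" "\<And>g. g \<in> carrier G \<Longrightarrow> g \<otimes> a [^] m \<otimes> inv g \<in> H"
  obtains N where "card (fixed_rcosets G H a) + m * N = card (rcosets H)"
    and "(\<Sum>s\<in>double_cosets G H a. f (return_time G H a (r s))) =
      frag_cmul (int (card (fixed_rcosets G H a))) (f 1) + frag_cmul (int N) (f m)"
proof -
  let ?D = "double_cosets G H a"
  define d where "d = (\<lambda>s. return_time G H a (r s))"
  define D1 where "D1 = {s \<in> ?D. d s = 1}"
  define Dm where "Dm = {s \<in> ?D. d s = m}"
  note finD = sum_return_time(1) [OF H a tor fin r]
  have "d s = 1 \<or> d s = m" if "s \<in> ?D" for s
  proof -
    have g: "r s \<in> carrier G" using double_coset_rep(1) [OF H a tor that r [OF that]] .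
    have "d s dvd m" using return_time_dvd_iff(3) [OF H a g tor, of m] m(2) [OF g] d_def by simp
    then show ?thesis using m(1) by (auto simp: prime_nat_iff)
  qed
  then have D: "?D = D1 \<union> Dm" "D1 \<inter> Dm = {}"
    using m(1) prime_gt_1_nat [OF m(1)] by (auto simp: D1_def Dm_def)
  have fins: "finite D1" "finite Dm" using finD by (auto simp: D1_def Dm_def)
  have D1_eq: "D1 = fixed_rcosets G H a"
    unfolding D1_def d_def using return_time_1_double_cosets [OF H a tor r] by simp
  have split: "sum g ?D = sum g D1 + sum g Dm" for g :: "_ \<Rightarrow> 'd::comm_monoid_add"
    unfolding D(1) by (rule sum.union_disjoint [OF fins D(2)])
  have "card (rcosets H) = sum d ?D"
    unfolding d_def using sum_return_time(2) [OF H a tor fin r] by simp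
  also have "\<dots> = (\<Sum>s\<in>D1. 1) + (\<Sum>s\<in>Dm. m)"
    unfolding split by (simp add: D1_def Dm_def)
  finally have "card (fixed_rcosets G H a) + m * card Dm = card (rcosets H)"
    by (simp add: D1_eq mult.commute)
  moreover have "(\<Sum>s\<in>?D. f (d s)) = (\<Sum>s\<in>D1. f 1) + (\<Sum>s\<in>Dm. f m)"
    unfolding split by (simp add: D1_def Dm_def)
  ultimately show ?thesis using that by (simp add: sum_const_frag D1_eq d_def)
qed

section \<open>Conjugacy classes and the pushforward of a pullback\<close>

lemma (in group) conj_class_conj:
  assumes "a \<in> carrier G" "h \<in> carrier G"
  shows "conj_class G (h \<otimes> a \<otimes> inv h) = conj_class G a"
proof (intro equalityI subsetI)
  fix x assume "x \<in> conj_class G (h \<otimes> a \<otimes> inv h)"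
  then obtain g where g: "g \<in> carrier G" "x = g \<otimes> (h \<otimes> a \<otimes> inv h) \<otimes> inv g"
    by (auto simp: conj_class_def)
  then have "x = (g \<otimes> h) \<otimes> a \<otimes> inv (g \<otimes> h)" using assms by (simp add: m_assoc inv_mult_group)
  then show "x \<in> conj_class G a" using g assms by (auto simp: conj_class_def)
next
  fix x assume "x \<in> conj_class G a"
  then obtain g where g: "g \<in> carrier G" "x = g \<otimes> a \<otimes> inv g"
    by (auto simp: conj_class_def)
  have "g \<otimes> inv h \<otimes> (h \<otimes> a \<otimes> inv h) \<otimes> inv (g \<otimes> inv h)
      = g \<otimes> (inv h \<otimes> (h \<otimes> (a \<otimes> (inv h \<otimes> (h \<otimes> inv g)))))"
    using assms g by (simp add: m_assoc inv_mult_group)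
  also have "\<dots> = x" using assms g by (simp add: m_assoc inv_solve_left')
  finally have "x = (g \<otimes> inv h) \<otimes> (h \<otimes> a \<otimes> inv h) \<otimes> inv (g \<otimes> inv h)" ..
  then show "x \<in> conj_class G (h \<otimes> a \<otimes> inv h)"
    using g assms unfolding conj_class_def by blast
qed

lemma (in group) conj_class_self: "a \<in> carrier G \<Longrightarrow> a \<in> conj_class G a"
  unfolding conj_class_def by (force intro: exI [of _ \<one>])

lemma (in group) class_rep_conj_class:
  assumes "a \<in> carrier G"
  obtains h where "h \<in> carrier G" "class_rep (conj_class G a) = h \<otimes> a \<otimes> inv h"
proof -
  have "class_rep (conj_class G a) \<in> conj_class G a"
    unfolding class_rep_def using conj_class_self [OF assms] by (rule someI)
  then show ?thesis using that by (auto simp: conj_class_def)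
qed

lemma (in group) double_coset_nonempty:
  assumes H: "subgroup H G" and a: "a \<in> carrier G" and s: "s \<in> double_cosets G H a"
  shows "s \<noteq> {}"
proof -
  obtain g where g: "g \<in> carrier G" "s = (H #> g) <#> generate G {a}"
    using s unfolding double_cosets_def by auto
  have "g \<in> H #> g" using rcos_self [OF g(1) H] .
  moreover have "\<one> \<in> generate G {a}" by (rule generate.one)
  ultimately have "g \<otimes> \<one> \<in> s" unfolding g(2) set_mult_def by blast
  then show ?thesis by blast
qed

text \<open>Conjugating by the representative of a double coset is invisible in the classes of
  \<open>G\<close>, so only a power of \<open>a\<close> remains. The map is required to preserve
  classes only on elements of \<open>H\<close> killed by \<open>n\<close>, so that the statement
  covers both the inclusion and \<open>pi_op\<close>.\<close>

lemma (in group) pushforward_pullback: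
  fixes c
  defines "a \<equiv> class_rep c"
  assumes H: "subgroup H G" and a: "a \<in> carrier G"
    and tor: "0 < n" "a [^] (n::nat) = \<one>" and fin: "finite (rcosets H)"
    and \<psi>: "\<And>y. y \<in> H \<Longrightarrow> y [^] n = \<one> \<Longrightarrow> conj_class G (\<psi> y) = conj_class G y"
  shows "pushforward G \<psi> (pullback G H (frag_of c)) =
    (\<Sum>s\<in>double_cosets G H a.
      frag_of (conj_class G (a [^] return_time G H a (SOME g. g \<in> s))))"
proof -
  let ?D = "double_cosets G H a"
  let ?H = "G\<lparr>carrier := H\<rparr>"
  define r :: "'a set \<Rightarrow> 'a" where "r = (\<lambda>s. SOME g. g \<in> s)"
  define x where "x = (\<lambda>s. r s \<otimes> a [^] return_time G H a (r s) \<otimes> inv (r s))"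
  interpret HG: group ?H using subgroup.subgroup_is_group [OF H is_group] .
  have HG: "H \<subseteq> carrier G" using H subgroup.subset by blast
  have r: "r s \<in> s" if "s \<in> ?D" for s
    unfolding r_def by (rule someI_ex) (use double_coset_nonempty [OF H a that] in blast)
  note finD = sum_return_time(1) [OF H a tor fin r]
  have cls: "conj_class G (\<psi> (class_rep (conj_class ?H (x s)))) =
      conj_class G (a [^] return_time G H a (r s))" if s: "s \<in> ?D" for s
  proof -
    have g: "r s \<in> carrier G" using double_coset_rep(1) [OF H a tor s r [OF s]] .
    have xH: "x s \<in> H" unfolding x_def using return_time_in [OF H a g tor] .
    \<comment> \<open>The representative of a class of \<open>H\<close> is known only up to
      conjugation in \<open>H\<close>; it stays in \<open>H\<close>, is still killed by
      \<open>n\<close>, and has the same class in \<open>G\<close>.\<close>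
    obtain h where h: "h \<in> H" and y: "class_rep (conj_class ?H (x s)) = h \<otimes> x s \<otimes> inv\<^bsub>?H\<^esub> h"
      using HG.class_rep_conj_class [of "x s"] xH by auto
    have yG: "class_rep (conj_class ?H (x s)) = h \<otimes> x s \<otimes> inv h"
      using y m_inv_consistent [OF H h] by simp
    have hG: "h \<in> carrier G" "x s \<in> carrier G" using h xH HG by auto
    have "x s [^] n = \<one>"
    proof -
      have "x s [^] n = r s \<otimes> (a [^] return_time G H a (r s)) [^] n \<otimes> inv (r s)"
        unfolding x_def using conj_nat_pow a g by simp
      also have "(a [^] return_time G H a (r s)) [^] n = \<one>"
        using a tor(2) by (metis mult.commute nat_pow_one nat_pow_pow)
      finally show ?thesis using g by simp
    qed
    then have "(h \<otimes> x s \<otimes> inv h) [^] n = \<one>"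
      using conj_nat_pow [OF hG(2,1), of n] hG by simp
    moreover have "h \<otimes> x s \<otimes> inv h \<in> H" using H h xH by (simp add: subgroup.m_closed subgroup.m_inv_closed)
    ultimately have "conj_class G (\<psi> (h \<otimes> x s \<otimes> inv h)) = conj_class G (h \<otimes> x s \<otimes> inv h)" using \<psi> by blast
    also have "\<dots> = conj_class G (x s)" using conj_class_conj hG by blast
    also have "\<dots> = conj_class G (a [^] return_time G H a (r s))"
      unfolding x_def using conj_class_conj a g by blast
    finally show ?thesis unfolding yG .
  qed
  have "pullback G H (frag_of c) = (\<Sum>s\<in>?D. frag_of (conj_class ?H (x s)))"
    by (simp add: pullback_def Let_def a_def [symmetric] x_def r_def)
  then have "pushforward G \<psi> (pullback G H (frag_of c)) =
      (\<Sum>s\<in>?D. frag_of (conj_class G (\<psi> (class_rep (conj_class ?H (x s))))))"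
    by (simp add: pushforward_def frag_extend_sum [OF finD] o_def)
  also have "\<dots> = (\<Sum>s\<in>?D. frag_of (conj_class G (a [^] return_time G H a (r s))))"
    using cls by (intro sum.cong) auto
  finally show ?thesis unfolding r_def .
qed


section \<open>Quadratic roots modulo a prime\<close>

text \<open>By Vieta the other root is \<open>u - r\<close>: modulo \<open>p\<close> the polynomial
  factors as \<open>(j - r) * (j - (u - r))\<close>.\<close>

lemma mod_quadratic_roots:
  fixes u r :: int
  assumes p: "prime p" and r: "int p dvd r\<^sup>2 - u * r + 1"
  shows "{j \<in> {0..<int p}. int p dvd j\<^sup>2 - u * j + 1} = {r mod int p, (u - r) mod int p}"
proof -
  have pp: "prime (int p)" "0 < int p" using p prime_gt_0_nat by auto
  have "int p dvd j\<^sup>2 - u * j + 1 \<longleftrightarrow> int p dvd j - r \<or> int p dvd j - (u - r)" for j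
  proof -
    have "j\<^sup>2 - u * j + 1 = (j - r) * (j - (u - r)) + (r\<^sup>2 - u * r + 1)"
      by (simp add: algebra_simps power2_eq_square)
    then have "int p dvd j\<^sup>2 - u * j + 1 \<longleftrightarrow> int p dvd (j - r) * (j - (u - r))"
      using r by (metis dvd_add_left_iff)
    then show ?thesis using pp(1) by (simp add: prime_dvd_mult_iff)
  qed
  moreover have "int p dvd j - x \<longleftrightarrow> j = x mod int p" if "j \<in> {0..<int p}" for j x
    using that by (auto simp: mod_eq_dvd_iff [symmetric])
  ultimately show ?thesis using pp(2) by auto
qed

text \<open>The two roots coincide exactly when \<open>p\<close> divides the discriminant, which is
  congruent to the square of their difference.\<close>

lemma card_mod_quadratic_roots:
  fixes u r :: int
  assumes p: "prime p" and r: "int p dvd r\<^sup>2 - u * r + 1"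
  shows "card {j \<in> {0..<int p}. int p dvd j\<^sup>2 - u * j + 1} = (if int p dvd u\<^sup>2 - 4 then 1 else 2)"
proof -
  have pp: "prime (int p)" using p by simp
  have "u\<^sup>2 - 4 = (2 * r - u)\<^sup>2 - 4 * (r\<^sup>2 - u * r + 1)"
    by (simp add: algebra_simps power2_eq_square)
  then have "int p dvd u\<^sup>2 - 4 \<longleftrightarrow> int p dvd (2 * r - u)\<^sup>2"
    using dvd_diff_left_iff [OF dvd_mult [OF r, of 4]] by metis
  also have "\<dots> \<longleftrightarrow> int p dvd r - (u - r)"
    using pp by (simp add: prime_dvd_power_iff algebra_simps)
  also have "\<dots> \<longleftrightarrow> r mod int p = (u - r) mod int p"
    by (simp add: mod_eq_dvd_iff)
  finally show ?thesis unfolding mod_quadratic_roots [OF assms] by simp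
qed

text \<open>If \<open>g\<close> is a primitive root, its power with exponent
  \<open>(p - 1) / m\<close> has order exactly \<open>m\<close>.\<close>

lemma mod_unit_root_exists:
  assumes p: "prime p" and m: "1 < m" "m dvd p - 1"
  obtains x :: nat where "[x ^ m = 1] (mod p)" and "\<And>k. 0 < k \<Longrightarrow> k < m \<Longrightarrow> [x ^ k \<noteq> 1] (mod p)"
proof -
  obtain g where g: "residue_primroot p g" using prime_primitive_root_exists [OF prime_gt_1_nat [OF p] p] ..
  then have og: "ord p g = p - 1" using p by (simp add: residue_primroot_def totient_prime)
  obtain q where q: "p - 1 = m * q" using m(2) by blast
  have "0 < q" using q prime_gt_1_nat [OF p] by (cases q) auto
  have iff: "[(g ^ q) ^ k = 1] (mod p) \<longleftrightarrow> m dvd k" for k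
  proof -
    have "[(g ^ q) ^ k = 1] (mod p) \<longleftrightarrow> m * q dvd q * k"
      using ord_divides [of g "q * k" p] unfolding og q by (simp add: power_mult)
    then show ?thesis using \<open>0 < q\<close> by (simp add: mult.commute [of m])
  qed
  show ?thesis
  proof (rule that [of "g ^ q"])
    show "[(g ^ q) ^ m = 1] (mod p)" using iff by simp
    show "[(g ^ q) ^ k \<noteq> 1] (mod p)" if "0 < k" "k < m" for k
      using that iff by (auto dest: dvd_imp_le)
  qed
qed

lemma fermat_int:
  fixes x :: int
  assumes p: "prime p" and "\<not> int p dvd x"
  shows "[x ^ (p - 1) = 1] (mod int p)"
proof -
  define y where "y = nat (x mod int p)"
  have y: "[int y = x] (mod int p)" using prime_gt_0_nat [OF p] by (simp add: y_def cong_def)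
  then have "\<not> p dvd y" using assms(2) by (metis cong_dvd_iff int_dvd_int_iff cong_sym cong_def dvd_eq_mod_eq_0)
  then have "[y ^ (p - 1) = 1] (mod p)" using p by (rule fermat_theorem [rotated])
  then have "[int y ^ (p - 1) = 1] (mod int p)" by (metis cong_int_iff of_nat_1 of_nat_power)
  then show ?thesis using y by (metis cong_pow cong_sym cong_trans)
qed

text \<open>The polynomial is the fourth cyclotomic one: its roots are primitive fourth roots of
  unity when \<open>p\<close> is odd. The term \<open>0 * j\<close> keeps the shape of
  \<open>card_mod_quadratic_roots\<close> with \<open>u = 0\<close>.\<close>

lemma card_roots_order_4:
  assumes p: "prime p"
  shows "card {j \<in> {0..<int p}. int p dvd j\<^sup>2 - 0 * j + 1} =
    (if p = 2 then 1 else if [p = 1] (mod 4) then 2 else 0)"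
proof -
  have "p = 2 \<or> [p = 1] (mod 4) \<or> [p = 3] (mod 4)"
  proof (cases "p = 2")
    case False
    then have "odd p" using p prime_odd_nat [of p] prime_gt_1_nat [OF p] by linarith
    then have "p mod 4 = 1 \<or> p mod 4 = 3" by presburger
    then show ?thesis by (auto simp: cong_def)
  qed simp
  then consider "p = 2" | "[p = 1] (mod 4)" | "[p = 3] (mod 4)" by blast
  then show ?thesis
  proof cases
    case 1
    then show ?thesis using card_mod_quadratic_roots [OF p, of 1 0] by simp
  next
    case 2
    then have "4 dvd p - 1" using prime_gt_1_nat [OF p] by (simp add: cong_def) presburger
    then obtain x where xm: "[x ^ 4 = 1] (mod p)"
        and xk: "\<And>k. 0 < k \<Longrightarrow> k < 4 \<Longrightarrow> [x ^ k \<noteq> 1] (mod p)"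
      using mod_unit_root_exists [OF p, of 4] by (auto simp del: One_nat_def)
    have x: "[x ^ 4 = 1] (mod p)" "[x ^ 2 \<noteq> 1] (mod p)"
      using xm xk [of 2] by auto
    have p2: "p \<noteq> 2" using 2 by (auto simp: cong_def)
    have "int p dvd int x ^ 4 - 1"
      using x(1) by (metis cong_iff_dvd_diff cong_int_iff of_nat_1 of_nat_power)
    moreover have "\<not> int p dvd int x ^ 2 - 1"
      using x(2) by (metis cong_iff_dvd_diff cong_int_iff of_nat_1 of_nat_power)
    moreover have "int x ^ 4 - 1 = (int x ^ 2 - 1) * (int x ^ 2 - 0 * int x + 1)"
      by (simp add: algebra_simps power2_eq_square power4_eq_xxxx)
    ultimately have root: "int p dvd int x ^ 2 - 0 * int x + 1"
      using p by (metis prime_dvd_mult_iff prime_nat_int_transfer)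
    have "\<not> int p dvd - 4"
    proof
      assume "int p dvd - 4"
      then have "p dvd 2 ^ 2" by (simp add: int_dvd_int_iff [of p 4, simplified])
      then show False using p p2 by (metis prime_dvd_power primes_dvd_imp_eq two_is_prime_nat)
    qed
    then show ?thesis using card_mod_quadratic_roots [OF p root] 2 p2 by simp
  next
    case 3
    have "False" if r: "int p dvd j\<^sup>2 - 0 * j + 1" for j
    proof -
      have j2: "[j ^ 2 = - 1] (mod int p)" using r by (simp add: cong_iff_dvd_diff)
      have "\<not> int p dvd j"
      proof
        assume "int p dvd j"
        then have "int p dvd j\<^sup>2" by (simp add: power2_eq_square)
        then have "int p dvd 1" using r by (metis dvd_add_right_iff mult_zero_left diff_zero)
        then show False using p prime_gt_1_nat [OF p] by simp
      qed
      note fm = fermat_int [OF p this]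
      define k where "k = p div 4"
      \<comment> \<open>Half of \<open>p - 1\<close> is odd, so a square root of \<open>-1\<close>
        would have \<open>(p - 1)\<close>-th power \<open>-1\<close>, against Fermat.\<close>
      have k: "p - 1 = 2 * (2 * k + 1)" using 3 unfolding k_def by (simp add: cong_def) presburger
      have "[j ^ (p - 1) = (- 1) ^ (2 * k + 1)] (mod int p)"
        unfolding k power_mult by (rule cong_pow [OF j2])
      then have "[1 = - 1] (mod int p)" using fm by (simp add: cong_def)
      then have "int p dvd int 2" by (simp add: cong_iff_dvd_diff)
      then have "p dvd 2" by (simp only: int_dvd_int_iff)
      then have "p \<le> 2" by (auto dest: dvd_imp_le)
      then show False using 3 by (auto simp: cong_def)
    qed
    then have none: "{j \<in> {0..<int p}. int p dvd j\<^sup>2 - 0 * j + 1} = {}" by blast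
    have "p \<noteq> 2" "\<not> [p = 1] (mod 4)" using 3 by (auto simp: cong_def)
    then show ?thesis unfolding none by simp
  qed
qed

text \<open>For \<open>u = -1\<close> and \<open>u = 1\<close> these are the third and sixth
  cyclotomic polynomials. Multiplication of the variable by \<open>-u\<close> reduces both to the
  third, that is, to cube roots of unity.\<close>

lemma card_roots_order_3_6:
  fixes u :: int
  assumes p: "prime p" and u: "u = 1 \<or> u = - 1"
  shows "card {j \<in> {0..<int p}. int p dvd j\<^sup>2 - u * j + 1} =
    (if p = 3 then 1 else if [p = 1] (mod 3) then 2 else 0)"
proof -
  have u2: "u * u = 1" using u by auto
  have "p = 3 \<or> [p = 1] (mod 3) \<or> [p = 2] (mod 3)"
  proof (cases "p = 3")
    case False
    then have "\<not> 3 dvd p" using p primes_dvd_imp_eq [of 3 p] by auto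
    then have "p mod 3 = 1 \<or> p mod 3 = 2" by presburger
    then show ?thesis by (auto simp: cong_def)
  qed simp
  then consider "p = 3" | "[p = 1] (mod 3)" | "[p = 2] (mod 3)" by blast
  then show ?thesis
  proof cases
    case 1
    \<comment> \<open>Modulo 3 the root \<open>-u\<close> is double, as the discriminant is
      \<open>-3\<close>.\<close>
    have "int p dvd (- u)\<^sup>2 - u * (- u) + 1" using u2 1 by (simp add: power2_eq_square)
    from card_mod_quadratic_roots [OF p this] show ?thesis using 1 u2 by (simp add: power2_eq_square)
  next
    case 2
    then have "3 dvd p - 1" using prime_gt_1_nat [OF p] by (simp add: cong_def) presburger
    then obtain x where xm: "[x ^ 3 = 1] (mod p)"
        and xk: "\<And>k. 0 < k \<Longrightarrow> k < 3 \<Longrightarrow> [x ^ k \<noteq> 1] (mod p)"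
      using mod_unit_root_exists [OF p, of 3] by (auto simp del: One_nat_def)
    have x: "[x ^ 3 = 1] (mod p)" "[x ^ 1 \<noteq> 1] (mod p)"
      using xm xk [of 1] by auto
    have p3: "p \<noteq> 3" using 2 by (auto simp: cong_def)
    have "int p dvd int x ^ 3 - 1"
      using x(1) by (metis cong_iff_dvd_diff cong_int_iff of_nat_1 of_nat_power)
    moreover have "\<not> int p dvd int x - 1"
      using x(2) by (metis cong_iff_dvd_diff cong_int_iff of_nat_1 power_one_right)
    moreover have "int x ^ 3 - 1 = (int x - 1) * ((- u * int x)\<^sup>2 - u * (- u * int x) + 1)"
      using u by (auto simp: algebra_simps power2_eq_square power3_eq_cube)
    ultimately have root: "int p dvd (- u * int x)\<^sup>2 - u * (- u * int x) + 1"
      using p by (metis prime_dvd_mult_iff prime_nat_int_transfer)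
    have "\<not> int p dvd - 3"
    proof
      assume "int p dvd - 3"
      then have "p dvd 3" by (simp add: int_dvd_int_iff [of p 3, simplified])
      then show False using p p3 primes_dvd_imp_eq [of p 3] by auto
    qed
    then show ?thesis using card_mod_quadratic_roots [OF p root] 2 p3 u2 by (simp add: power2_eq_square)
  next
    case 3
    have "False" if r: "int p dvd j\<^sup>2 - u * j + 1" for j
    proof -
      define y where "y = - u * j"
      have ry: "int p dvd y\<^sup>2 + y + 1" using r u by (auto simp: y_def)
      have "y ^ 3 - 1 = (y - 1) * (y\<^sup>2 + y + 1)"
        by (simp add: algebra_simps power2_eq_square power3_eq_cube)
      then have y3: "[y ^ 3 = 1] (mod int p)" using ry by (simp add: cong_iff_dvd_diff)
      have "\<not> int p dvd y"
      proof
        assume "int p dvd y"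
        then have "int p dvd y\<^sup>2 + y" by (simp add: power2_eq_square)
        then have "int p dvd 1" using ry by (metis dvd_add_right_iff)
        then show False using p prime_gt_1_nat [OF p] by simp
      qed
      note fm = fermat_int [OF p this]
      define k where "k = p div 3"
      \<comment> \<open>Since \<open>y\<close> has cube 1, its \<open>(p - 1)\<close>-th power is
        \<open>y\<close> itself. Fermat then gives \<open>y = 1\<close>, and the quadratic takes the
        value 3.\<close>
      have k: "p - 1 = 3 * k + 1" using 3 unfolding k_def by (simp add: cong_def) presburger
      have "[(y ^ 3) ^ k * y = 1 ^ k * y] (mod int p)"
        by (rule cong_mult [OF cong_pow [OF y3] cong_refl])
      then have "[y = 1] (mod int p)" using fm unfolding k by (simp add: power_add power_mult cong_def mult.commute [of y])
      then have "[y\<^sup>2 + y + 1 = 1\<^sup>2 + 1 + 1] (mod int p)"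
        by (intro cong_add cong_pow cong_refl)
      then have "int p dvd int 3" using ry by (simp add: cong_dvd_iff)
      then have "p dvd 3" by (simp only: int_dvd_int_iff)
      then have "p = 3" using p primes_dvd_imp_eq [of p 3] by auto
      then show False using 3 by (auto simp: cong_def)
    qed
    then have none: "{j \<in> {0..<int p}. int p dvd j\<^sup>2 - u * j + 1} = {}" by blast
    have "p \<noteq> 3" "\<not> [p = 1] (mod 3)" using 3 by (auto simp: cong_def)
    then show ?thesis unfolding none by simp
  qed
qed


section \<open>The modular group and its subgroup of level p\<close>

definition mat2 :: "'a \<Rightarrow> 'a \<Rightarrow> 'a \<Rightarrow> 'a \<Rightarrow> 'a::comm_ring_1^2^2" where
  "mat2 a b c d = vector [vector [a, b], vector [c, d]]"

lemma mat2_nth [simp]: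
  "mat2 a b c d $ 1 $ 1 = a" "mat2 a b c d $ 1 $ 2 = b"
  "mat2 a b c d $ 2 $ 1 = c" "mat2 a b c d $ 2 $ 2 = d"
  by (simp_all add: mat2_def)

lemma mat2_eta: "A = mat2 (A $ 1 $ 1) (A $ 1 $ 2) (A $ 2 $ 1) (A $ 2 $ 2)"
  by (simp add: vec_eq_iff forall_2)

lemma mat2_eq_iff [simp]:
  "mat2 a b c d = mat2 a' b' c' d' \<longleftrightarrow> a = a' \<and> b = b' \<and> c = c' \<and> d = d'"
  by (auto simp: vec_eq_iff forall_2)

lemma mat2_mult [simp]:
  "mat2 a b c d ** mat2 a' b' c' d' =
    mat2 (a * a' + b * c') (a * b' + b * d') (c * a' + d * c') (c * b' + d * d')"
  by (simp add: vec_eq_iff forall_2 matrix_matrix_mult_def sum_2)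

lemma mat_1_eq_mat2: "mat 1 = mat2 1 0 0 1"
  by (simp add: vec_eq_iff forall_2 mat_def)

lemma mat2_one_mult [simp]: "mat2 1 0 0 1 ** A = A"
  by (metis mat_1_eq_mat2 matrix_mul_lid)

lemma uminus_mat_1_eq_mat2: "- mat 1 = mat2 (- 1) 0 0 (- 1)"
  by (simp add: vec_eq_iff forall_2 mat_def)

lemma det_mat2 [simp]: "det (mat2 a b c d) = a * d - b * c"
  by (simp add: det_2)

lemma mat2_in_SL2Z [simp]: "mat2 a b c d \<in> carrier SL2Z \<longleftrightarrow> a * d - b * c = 1"
  by (simp add: SL2Z_def)

lemma mult_SL2Z [simp]: "A \<otimes>\<^bsub>SL2Z\<^esub> B = A ** B"
  by (simp add: SL2Z_def)

lemma one_SL2Z [simp]: "\<one>\<^bsub>SL2Z\<^esub> = mat2 1 0 0 1"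
  by (simp add: SL2Z_def mat_1_eq_mat2)

lemma SL2Z_E:
  assumes "A \<in> carrier SL2Z"
  obtains a b c d where "A = mat2 a b c d" "a * d - b * c = 1"
  using assms mat2_eta [of A] by (metis mat2_in_SL2Z)

lemma group_SL2Z: "group SL2Z"
proof (rule groupI)
  fix A assume "A \<in> carrier SL2Z"
  then obtain a b c d where A: "A = mat2 a b c d" "a * d - b * c = 1" by (rule SL2Z_E)
  then have "mat2 d (- b) (- c) a \<in> carrier SL2Z" "mat2 d (- b) (- c) a \<otimes>\<^bsub>SL2Z\<^esub> A = \<one>\<^bsub>SL2Z\<^esub>"
    by (simp_all add: algebra_simps)
  then show "\<exists>B\<in>carrier SL2Z. B \<otimes>\<^bsub>SL2Z\<^esub> A = \<one>\<^bsub>SL2Z\<^esub>" by blast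
qed (auto simp: SL2Z_def det_mul matrix_mul_assoc mat_1_eq_mat2 [symmetric])

interpretation SL2Z: group SL2Z
  by (rule group_SL2Z)

lemma inv_SL2Z [simp]:
  assumes "a * d - b * c = 1"
  shows "inv\<^bsub>SL2Z\<^esub> (mat2 a b c d) = mat2 d (- b) (- c) a"
  using assms by (intro SL2Z.inv_equality) (simp_all add: algebra_simps)

lemma mat2_in_Gamma0 [simp]: "mat2 a b c d \<in> Gamma0 p \<longleftrightarrow> a * d - b * c = 1 \<and> int p dvd c"
  by (simp add: Gamma0_def)

lemma subgroup_Gamma0: "subgroup (Gamma0 p) SL2Z"
proof (rule SL2Z.subgroupI)
  show "Gamma0 p \<subseteq> carrier SL2Z" by (auto simp: Gamma0_def)
  have "mat2 1 0 0 1 \<in> Gamma0 p" by simp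
  then show "Gamma0 p \<noteq> {}" by blast
next
  fix A assume A: "A \<in> Gamma0 p"
  then obtain a b c d where "A = mat2 a b c d" "a * d - b * c = 1"
    by (auto simp: Gamma0_def elim: SL2Z_E)
  with A show "inv\<^bsub>SL2Z\<^esub> A \<in> Gamma0 p" by (simp add: mult.commute)
next
  fix A B assume AB: "A \<in> Gamma0 p" "B \<in> Gamma0 p"
  then have "A \<in> carrier SL2Z" "B \<in> carrier SL2Z" by (auto simp: Gamma0_def)
  then have "A \<otimes>\<^bsub>SL2Z\<^esub> B \<in> carrier SL2Z" by (rule SL2Z.m_closed)
  moreover have "int p dvd (A ** B) $ 2 $ 1"
    using AB by (simp add: Gamma0_def matrix_matrix_mult_def sum_2)
  ultimately show "A \<otimes>\<^bsub>SL2Z\<^esub> B \<in> Gamma0 p" by (simp add: Gamma0_def)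
qed

text \<open>
  A right coset of \<open>Gamma0 p\<close> is a point of the projective line over \<open>F\<^sub>p\<close>, read off from the
  bottom row: \<open>coset_rep j\<close> is the point \<open>(1 : j)\<close>, and \<open>Gamma0 p\<close> itself is \<open>(0 : 1)\<close>.
\<close>
definition coset_rep :: "int \<Rightarrow> int^2^2" where
  "coset_rep j = mat2 0 (- 1) 1 j"

text \<open>The lower left entry of the quotient of the two matrices is \<open>c * j - d\<close>: it
  vanishes modulo \<open>p\<close> when \<open>(c : d)\<close> and \<open>(1 : j)\<close> are the
  same point.\<close>

lemma Gamma0_r_coset_eq_coset_rep:
  assumes "a * d - b * c = 1"
  shows "Gamma0 p #>\<^bsub>SL2Z\<^esub> mat2 a b c d = Gamma0 p #>\<^bsub>SL2Z\<^esub> coset_rep j \<longleftrightarrow> int p dvd c * j - d"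
proof -
  have "mat2 a b c d \<otimes>\<^bsub>SL2Z\<^esub> inv\<^bsub>SL2Z\<^esub> coset_rep j = mat2 (a * j - b) a (c * j - d) c"
    by (simp add: coset_rep_def)
  moreover have "(a * j - b) * c - a * (c * j - d) = 1" using assms by (simp add: algebra_simps)
  moreover have "coset_rep j \<in> carrier SL2Z" by (simp add: coset_rep_def)
  ultimately show ?thesis
    using SL2Z.r_coset_eq_iff [OF subgroup_Gamma0, of "mat2 a b c d" "coset_rep j" p] assms by simp
qed

lemma Gamma0_r_coset_eq_self:
  assumes "a * d - b * c = 1"
  shows "Gamma0 p #>\<^bsub>SL2Z\<^esub> mat2 a b c d = Gamma0 p \<longleftrightarrow> int p dvd c"
  using assms SL2Z.coset_join1 [OF _ _ subgroup_Gamma0] SL2Z.coset_join2 [OF _ subgroup_Gamma0]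
  by (metis mat2_in_Gamma0 mat2_in_SL2Z)

text \<open>A bottom row with \<open>p\<close> dividing \<open>c\<close> is the point
  \<open>(0 : 1)\<close>. Otherwise \<open>c\<close> is invertible modulo \<open>p\<close> and the
  row is the point \<open>(1 : d / c)\<close>.\<close>

lemma rcosets_Gamma0:
  assumes "prime p"
  shows "rcosets\<^bsub>SL2Z\<^esub> Gamma0 p =
    insert (Gamma0 p) ((\<lambda>j. Gamma0 p #>\<^bsub>SL2Z\<^esub> coset_rep j) ` {0..<int p})" (is "?L = ?R")
proof
  have "coset_rep j \<in> carrier SL2Z" for j by (simp add: coset_rep_def)
  then show "?R \<subseteq> ?L"
    using subgroup.subset [OF subgroup_Gamma0] subgroup.subgroup_in_rcosets [OF subgroup_Gamma0 group_SL2Z]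
    by (auto intro!: SL2Z.rcosetsI)
  show "?L \<subseteq> ?R"
  proof
    fix C assume "C \<in> ?L"
    then obtain g where g: "g \<in> carrier SL2Z" "C = Gamma0 p #>\<^bsub>SL2Z\<^esub> g"
      unfolding RCOSETS_def by auto
    then obtain a b c d where abcd: "g = mat2 a b c d" "a * d - b * c = 1" by (elim SL2Z_E)
    show "C \<in> ?R"
    proof (cases "int p dvd c")
      case True
      then show ?thesis using Gamma0_r_coset_eq_self [OF abcd(2)] g abcd by simp
    next
      case False
      then have "coprime c (int p)"
        using assms by (metis coprime_commute prime_imp_coprime prime_nat_int_transfer)
      then obtain c' where c': "[c * c' = 1] (mod int p)" using cong_solve_coprime_int by blast
      define j where "j = c' * d mod int p"
      have "[c * j = c * (c' * d)] (mod int p)" by (simp add: j_def cong_def mod_mult_right_eq)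
      moreover have "[c * (c' * d) = d] (mod int p)"
        using cong_mult [OF c' cong_refl [of d]] by (simp add: mult.assoc)
      ultimately have "int p dvd c * j - d" by (metis cong_iff_dvd_diff cong_trans)
      moreover have "j \<in> {0..<int p}" using prime_gt_0_nat [OF assms] by (simp add: j_def)
      ultimately show ?thesis using Gamma0_r_coset_eq_coset_rep [OF abcd(2)] g abcd by blast
    qed
  qed
qed

lemma inj_on_coset_rep: "inj_on (\<lambda>j. Gamma0 p #>\<^bsub>SL2Z\<^esub> coset_rep j) {0..<int p}"
proof (rule inj_onI)
  fix i j assume ij: "i \<in> {0..<int p}" "j \<in> {0..<int p}"
    "Gamma0 p #>\<^bsub>SL2Z\<^esub> coset_rep i = Gamma0 p #>\<^bsub>SL2Z\<^esub> coset_rep j"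
  then have "int p dvd j - i"
    using Gamma0_r_coset_eq_coset_rep [of 0 i "- 1" 1 p j] by (simp add: coset_rep_def [of i])
  then have "j mod int p = i mod int p" by (simp add: mod_eq_dvd_iff)
  then show "i = j" using ij by simp
qed

lemma Gamma0_coset_rep_neq:
  assumes "prime p"
  shows "Gamma0 p #>\<^bsub>SL2Z\<^esub> coset_rep j \<noteq> Gamma0 p"
  using Gamma0_r_coset_eq_self [of 0 j "- 1" 1 p] prime_gt_1_nat [OF assms] by (simp add: coset_rep_def)

lemma card_rcosets_Gamma0:
  assumes "prime p"
  shows "finite (rcosets\<^bsub>SL2Z\<^esub> Gamma0 p)" "card (rcosets\<^bsub>SL2Z\<^esub> Gamma0 p) = p + 1"
proof -
  have "Gamma0 p \<notin> (\<lambda>j. Gamma0 p #>\<^bsub>SL2Z\<^esub> coset_rep j) ` {0..<int p}"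
    using Gamma0_coset_rep_neq [OF assms] by auto
  then show "finite (rcosets\<^bsub>SL2Z\<^esub> Gamma0 p)" "card (rcosets\<^bsub>SL2Z\<^esub> Gamma0 p) = p + 1"
    by (simp_all add: rcosets_Gamma0 [OF assms] card_image [OF inj_on_coset_rep])
qed


section \<open>Elliptic elements\<close>

text \<open>The normal form of trace \<open>t\<close> and sign \<open>s\<close>; for
  \<open>s = 1\<close> it is a companion matrix of \<open>X^2 - t X + 1\<close>.\<close>

definition elliptic :: "int \<Rightarrow> int \<Rightarrow> int^2^2" where
  "elliptic s t = mat2 0 (- s) s t"

text \<open>The point \<open>(0 : 1)\<close> is moved because the lower left entry is a unit. At
  \<open>(1 : j)\<close> the conjugate has lower left entry \<open>s\<close> times the quadratic in
  \<open>j\<close>.\<close>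

lemma card_fixed_rcosets_elliptic:
  assumes p: "prime p" and s: "s = 1 \<or> s = - 1"
  shows "card (fixed_rcosets SL2Z (Gamma0 p) (elliptic s t)) =
    card {j \<in> {0..<int p}. int p dvd j\<^sup>2 - s * t * j + 1}"
proof -
  let ?f = "\<lambda>j. Gamma0 p #>\<^bsub>SL2Z\<^esub> coset_rep j"
  have ss: "s * s = 1" using s by auto
  have E: "elliptic s t \<in> carrier SL2Z" using ss by (simp add: elliptic_def)
  have rep: "coset_rep j \<in> carrier SL2Z" for j by (simp add: coset_rep_def)
  have "Gamma0 p #>\<^bsub>SL2Z\<^esub> elliptic s t \<noteq> Gamma0 p"
    using Gamma0_r_coset_eq_self [of 0 t "- s" s p] ss s prime_gt_1_nat [OF p] by (auto simp: elliptic_def)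
  moreover have "?f j #>\<^bsub>SL2Z\<^esub> elliptic s t = ?f j \<longleftrightarrow> int p dvd j\<^sup>2 - s * t * j + 1" for j
  proof -
    have "coset_rep j \<otimes>\<^bsub>SL2Z\<^esub> elliptic s t \<otimes>\<^bsub>SL2Z\<^esub> inv\<^bsub>SL2Z\<^esub> coset_rep j =
        mat2 (- s * j + t) (- s) (j * s * j - (- s + j * t)) (j * s)"
      by (simp add: coset_rep_def elliptic_def algebra_simps)
    moreover have "(- s * j + t) * (j * s) - (- s) * (j * s * j - (- s + j * t)) = 1"
      using ss by (simp add: algebra_simps)
    ultimately have "?f j #>\<^bsub>SL2Z\<^esub> elliptic s t = ?f j \<longleftrightarrow> int p dvd j * s * j - (- s + j * t)"
      using SL2Z.r_coset_fixed_iff [OF subgroup_Gamma0 E rep, of p j] by simp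
    also have "j * s * j - (- s + j * t) = s * (j\<^sup>2 - s * t * j + 1)"
      using s by (auto simp: algebra_simps power2_eq_square)
    also have "int p dvd s * (j\<^sup>2 - s * t * j + 1) \<longleftrightarrow> int p dvd j\<^sup>2 - s * t * j + 1"
      using s by (auto simp only: mult_1 mult_minus1 dvd_minus_iff)
    finally show ?thesis .
  qed
  ultimately have "fixed_rcosets SL2Z (Gamma0 p) (elliptic s t) =
      ?f ` {j \<in> {0..<int p}. int p dvd j\<^sup>2 - s * t * j + 1}"
    unfolding fixed_rcosets_def rcosets_Gamma0 [OF p] by auto
  moreover have "inj_on ?f {j \<in> {0..<int p}. int p dvd j\<^sup>2 - s * t * j + 1}"
    by (rule inj_on_subset [OF inj_on_coset_rep]) auto
  ultimately show ?thesis by (simp add: card_image)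
qed

section \<open>Reduction of elliptic elements\<close>

text \<open>Translation step of the reduction: conjugation by \<open>mat2 1 k 0 1\<close> keeps
  \<open>c\<close> and shifts \<open>a\<close> by a multiple of \<open>c\<close>.\<close>

lemma conj_class_translate:
  assumes "a * d - b * c = 1"
  shows "conj_class SL2Z (mat2 (a + k * c) (b + k * d - k * (a + k * c)) c (d - k * c)) =
    conj_class SL2Z (mat2 a b c d)"
proof -
  have eq: "mat2 1 k 0 1 \<otimes>\<^bsub>SL2Z\<^esub> mat2 a b c d \<otimes>\<^bsub>SL2Z\<^esub> inv\<^bsub>SL2Z\<^esub> (mat2 1 k 0 1) =
      mat2 (a + k * c) (b + k * d - k * (a + k * c)) c (d - k * c)"
    by (simp add: algebra_simps)
  have "mat2 a b c d \<in> carrier SL2Z" "mat2 1 k 0 1 \<in> carrier SL2Z" using assms by simp_all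
  from SL2Z.conj_class_conj [OF this] show ?thesis unfolding eq .
qed

text \<open>Inversion step: conjugation by \<open>mat2 0 (- 1) 1 0\<close> brings \<open>- b\<close>
  to the lower left corner.\<close>

lemma conj_class_invert:
  assumes "a * d - b * c = 1"
  shows "conj_class SL2Z (mat2 d (- c) (- b) a) = conj_class SL2Z (mat2 a b c d)"
  using SL2Z.conj_class_conj [of "mat2 a b c d" "mat2 0 (- 1) 1 0"] assms by simp

text \<open>The discriminant \<open>t^2 - 4\<close> is negative, so the attached form is definite.
  Hence \<open>c\<close> is nonzero and the inversion step keeps the sign of the lower left
  entry.\<close>

lemma elliptic_offdiag_neg:
  fixes a b c t :: int
  assumes det: "a * (t - a) - b * c = 1" and t: "\<bar>t\<bar> \<le> 1"
  shows "4 * (b * c) = t\<^sup>2 - 4 - (2 * a - t)\<^sup>2" and "b * c < 0" and "sgn (- b) = sgn c"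
proof -
  have "4 * (b * c) = 4 * (a * (t - a) - 1)" using det by simp
  then show eq: "4 * (b * c) = t\<^sup>2 - 4 - (2 * a - t)\<^sup>2"
    by (simp add: algebra_simps power2_eq_square)
  have "t\<^sup>2 \<le> 1" using t by (simp add: abs_square_le_1)
  then show neg: "b * c < 0" using eq zero_le_power2 [of "2 * a - t"] by linarith
  then show "sgn (- b) = sgn c" by (auto simp: mult_less_0_iff)
qed

text \<open>
  This is Gauss reduction of the definite form \<open>c X\<^sup>2 + (d - a) X Y - b Y\<^sup>2\<close> attached to an
  elliptic matrix: the discriminants \<open>-3\<close> and \<open>-4\<close> have class number one, so trace and sign
  determine the class.
\<close>
lemma conj_class_elliptic:
  assumes "a * (t - a) - b * c = 1" and t: "\<bar>t\<bar> \<le> 1"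
  shows "conj_class SL2Z (mat2 a b c (t - a)) = conj_class SL2Z (elliptic (sgn c) t)"
  using assms(1)
proof (induction "nat \<bar>c\<bar>" arbitrary: a b c rule: less_induct)
  case less
  note det = less.prems
  have "c \<noteq> 0" using elliptic_offdiag_neg(2) [OF det t] by auto
  have translate: "conj_class SL2Z (mat2 a b c (t - a)) =
      conj_class SL2Z (mat2 (a + k * c) (b + k * (t - a) - k * (a + k * c)) c (t - (a + k * c)))"
    and translate_det: "(a + k * c) * (t - (a + k * c)) - (b + k * (t - a) - k * (a + k * c)) * c = 1" for k
    using conj_class_translate [OF det, of k] det by (simp_all add: algebra_simps)
  show ?case
  proof (cases "\<bar>c\<bar> = 1")
    case True
    then have "c = 1 \<or> c = - 1" by linarith
    then have cc: "c * c = 1" and sgn: "sgn c = c" by auto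
    \<comment> \<open>This translation clears the upper left entry; the determinant then forces
      \<open>b' = - c\<close>.\<close>
    define k where "k = - (a * c)"
    have a': "a + k * c = 0" using cc by (simp add: k_def mult.assoc)
    define b' where "b' = b + k * (t - a) - k * (a + k * c)"
    have "- b' * c = 1" using translate_det [of k] unfolding b'_def [symmetric] unfolding a' by simp
    then have "b' * c * c = - c" by simp
    then have "b' = - c" using cc by (simp add: mult.assoc)
    then show ?thesis
      using translate [of k] unfolding b'_def [symmetric] unfolding a' by (simp add: sgn elliptic_def)
  next
    case False
    then have c2: "2 \<le> \<bar>c\<bar>" using \<open>c \<noteq> 0\<close> by linarith
    define m where "m = \<bar>c\<bar>"
    \<comment> \<open>Here \<open>q\<close> is \<open>(t - m) / 2\<close> rounded up. Moving
      \<open>a\<close> into the window of length \<open>m\<close> that starts at \<open>q\<close>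
      centres it, so that \<open>2 * a' - t\<close> is at most \<open>m\<close> in absolute
      value.\<close>
    define q where "q = (t - m + 1) div 2"
    define r where "r = (a - q) mod m"
    define a' where "a' = r + q"
    have "a' = a + (- ((a - q) div m) * sgn c) * c"
      using div_mult_mod_eq [of "a - q" "m"] by (simp add: a'_def r_def m_def algebra_simps abs_sgn)
    then obtain k where k: "a' = a + k * c" by blast
    define b' where "b' = b + k * (t - a) - k * (a + k * c)"
    have det': "a' * (t - a') - b' * c = 1" using translate_det [of k] k b'_def by simp
    have "0 \<le> r" "r < m" using \<open>c \<noteq> 0\<close> by (simp_all add: r_def m_def)
    moreover have "t - m \<le> 2 * q" "2 * q \<le> t - m + 1" unfolding q_def by linarith+
    ultimately have "\<bar>2 * a' - t\<bar> \<le> m" unfolding a'_def by presburger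
    then have "(2 * a' - t)\<^sup>2 \<le> c\<^sup>2" by (simp add: abs_le_square_iff m_def)
    moreover note neg = elliptic_offdiag_neg [OF det' t]
    ultimately have "4 * (- (b' * c)) \<le> c\<^sup>2 + 4"
      using zero_le_power2 [of t] by linarith
    moreover have "- (b' * c) = \<bar>b'\<bar> * \<bar>c\<bar>" using neg(2) by (simp add: abs_mult [symmetric])
    ultimately have le: "4 * (\<bar>b'\<bar> * \<bar>c\<bar>) \<le> \<bar>c\<bar> * \<bar>c\<bar> + 4" by (simp add: power2_eq_square)
    \<comment> \<open>Otherwise \<open>le\<close> would give \<open>3 c^2 <= 4\<close>, which fails
      once \<open>c\<close> has absolute value at least 2. Inverting therefore lowers the induction
      measure.\<close>
    have "\<bar>b'\<bar> < \<bar>c\<bar>"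
    proof (rule ccontr)
      assume "\<not> \<bar>b'\<bar> < \<bar>c\<bar>"
      then have "\<bar>c\<bar> * \<bar>c\<bar> \<le> \<bar>b'\<bar> * \<bar>c\<bar>" by (intro mult_right_mono) auto
      moreover have "2 * 2 \<le> \<bar>c\<bar> * \<bar>c\<bar>" using c2 by (intro mult_mono) auto
      ultimately show False using le by linarith
    qed
    then have "nat \<bar>- b'\<bar> < nat \<bar>c\<bar>" by simp
    moreover have "(t - a') * (t - (t - a')) - (- c) * (- b') = 1" using det' by (simp add: algebra_simps)
    ultimately have "conj_class SL2Z (mat2 (t - a') (- c) (- b') (t - (t - a'))) =
        conj_class SL2Z (elliptic (sgn (- b')) t)"
      by (rule less.hyps)
    then show ?thesis
      using conj_class_invert [OF det'] translate [of k] neg(3) by (simp add: k b'_def)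
  qed
qed

text \<open>
  By Cayley-Hamilton every positive power of a matrix of trace \<open>t\<close> has the form \<open>u A - v\<close>, and
  for \<open>\<bar>t\<bar> \<ge> 2\<close> the recurrence \<open>(u, v) \<mapsto> (t u - v, u)\<close> preserves \<open>\<bar>v\<bar> < \<bar>u\<bar>\<close>. So a torsion matrix
  that is not scalar has \<open>\<bar>t\<bar> \<le> 1\<close>.
\<close>
lemma SL2Z_torsion_cases:
  assumes A: "A \<in> carrier SL2Z" and tor: "0 < n" "A [^]\<^bsub>SL2Z\<^esub> (n::nat) = \<one>\<^bsub>SL2Z\<^esub>"
  obtains "A = mat2 1 0 0 1" | "A = mat2 (- 1) 0 0 (- 1)"
    | a b c t where "A = mat2 a b c (t - a)" "a * (t - a) - b * c = 1" "\<bar>t\<bar> \<le> 1"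
proof -
  obtain a b c d where abcd: "A = mat2 a b c d" "a * d - b * c = 1" using A by (rule SL2Z_E)
  show ?thesis
  proof (cases "\<bar>a + d\<bar> \<le> 1")
    case True
    then show ?thesis using that(3) [of a b c "a + d"] abcd by simp
  next
    case False
    have "\<exists>u v. A [^]\<^bsub>SL2Z\<^esub> Suc k = mat2 (u * a - v) (u * b) (u * c) (u * d - v) \<and> \<bar>v\<bar> < \<bar>u\<bar>" for k
    proof (induction k)
      case 0
      have "A [^]\<^bsub>SL2Z\<^esub> Suc 0 = mat2 (1 * a - 0) (1 * b) (1 * c) (1 * d - 0) \<and> \<bar>0\<bar> < \<bar>1::int\<bar>"
        using abcd by simp
      then show ?case by blast
    next
      case (Suc k)
      then obtain u v where uv: "A [^]\<^bsub>SL2Z\<^esub> Suc k = mat2 (u * a - v) (u * b) (u * c) (u * d - v)"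
        "\<bar>v\<bar> < \<bar>u\<bar>" by blast
      let ?w = "u * (a + d) - v"
      have "A [^]\<^bsub>SL2Z\<^esub> Suc (Suc k) = mat2 (?w * a - u) (?w * b) (?w * c) (?w * d - u)"
      proof -
        have "(u * a - v) * a + u * b * c = ?w * a - u * (a * d - b * c)"
          "u * c * b + (u * d - v) * d = ?w * d - u * (a * d - b * c)"
          by (simp_all add: algebra_simps)
        then show ?thesis
          unfolding SL2Z.nat_pow_Suc [of A "Suc k"] uv(1) abcd(2) unfolding abcd(1)
          by (simp add: algebra_simps)
      qed
      moreover have "\<bar>u\<bar> < \<bar>?w\<bar>"
      proof -
        have "\<bar>u\<bar> * 2 \<le> \<bar>u\<bar> * \<bar>a + d\<bar>" using False by (intro mult_left_mono) auto
        then have "2 * \<bar>u\<bar> \<le> \<bar>u * (a + d)\<bar>" by (simp add: abs_mult)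
        then show ?thesis using uv(2) by linarith
      qed
      ultimately show ?case by blast
    qed
    moreover obtain k where "n = Suc k" using tor(1) gr0_conv_Suc by blast
    ultimately obtain u v where uv: "mat2 (u * a - v) (u * b) (u * c) (u * d - v) = mat2 1 0 0 1" "\<bar>v\<bar> < \<bar>u\<bar>"
      using tor(2) by (metis one_SL2Z)
    \<comment> \<open>As \<open>u\<close> is nonzero, a power equal to the identity forces
      \<open>A\<close> itself to be scalar.\<close>
    then have bc: "b = 0" "c = 0" and "u \<noteq> 0" by auto
    moreover have "u * a = u * d" using uv(1) unfolding mat2_eq_iff by linarith
    ultimately have "a = d" by simp
    then have "a * a = 1" "d = a" using abcd(2) bc by auto
    then have "a = 1 \<or> a = - 1" by (metis square_eq_1_iff)
    then show ?thesis using that(1,2) abcd(1) bc \<open>d = a\<close> by auto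
  qed
qed

section \<open>Conjugation by \<open>g_mat p\<close> on torsion classes\<close>

text \<open>Conjugation by the diagonal matrix moves the factor \<open>p\<close> from the lower left
  to the upper right entry. The \<open>THE\<close> is well defined because integer matrices embed
  injectively into rational ones.\<close>

lemma pi_op_mat2:
  assumes "0 < p"
  shows "pi_op p (mat2 a b (int p * c) d) = mat2 a (int p * b) c d"
proof -
  have p0: "(of_nat p :: rat) \<noteq> 0" using assms by simp
  have g: "g_mat p = mat2 (of_nat p) 0 0 1" by (simp add: g_mat_def mat2_def)
  have mm: "map_matrix of_int (mat2 a b c d) = (mat2 (of_int a) (of_int b) (of_int c) (of_int d) :: rat^2^2)"
    for a b c d :: int
    by (simp add: vec_eq_iff forall_2 map_matrix_def)
  define J :: "rat^2^2" where "J = matrix_inv (g_mat p)"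
  have "invertible (g_mat p)"
    unfolding invertible_def g mat_1_eq_mat2
    by (rule exI [of _ "mat2 (1 / of_nat p) 0 0 1"]) (use p0 in simp)
  then have "J ** g_mat p = mat 1"
    unfolding J_def matrix_inv_def invertible_def by (rule someI2_ex) auto
  moreover have gi: "g_mat p ** mat2 (1 / of_nat p) 0 0 1 = mat 1"
    unfolding g mat_1_eq_mat2 using p0 by simp
  ultimately have J: "J = mat2 (1 / of_nat p) 0 0 1"
    by (metis matrix_mul_assoc matrix_mul_lid matrix_mul_rid)
  have "g_mat p ** map_matrix of_int (mat2 a b (int p * c) d) ** matrix_inv (g_mat p) =
      map_matrix of_int (mat2 a (int p * b) c d)"
    unfolding J_def [symmetric] unfolding J g mm using p0 by simp
  moreover have "B = C" if "(map_matrix of_int B :: rat^2^2) = map_matrix of_int C" for B C :: "int^2^2"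
    using that by (simp add: vec_eq_iff map_matrix_def)
  ultimately show ?thesis unfolding pi_op_def by (intro the_equality) auto
qed

text \<open>The diagonal is unchanged and dividing \<open>c\<close> by \<open>p\<close> keeps its
  sign, so \<open>conj_class_elliptic\<close> gives both matrices the same normal form. Scalar
  matrices are fixed by \<open>pi_op\<close>.\<close>

lemma conj_class_pi_op:
  assumes p: "0 < p" and A: "A \<in> Gamma0 p"
    and tor: "0 < n" "A [^]\<^bsub>SL2Z\<^esub> (n::nat) = \<one>\<^bsub>SL2Z\<^esub>"
  shows "conj_class SL2Z (pi_op p A) = conj_class SL2Z A"
proof -
  have "A \<in> carrier SL2Z" using A by (simp add: Gamma0_def)
  from this tor show ?thesis
  proof (cases rule: SL2Z_torsion_cases)
    case 1
    then show ?thesis using pi_op_mat2 [OF p, of 1 0 0 1] by simp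
  next
    case 2
    then show ?thesis using pi_op_mat2 [OF p, of "- 1" 0 0 "- 1"] by simp
  next
    case (3 a b c t)
    then have "int p dvd c" using A by simp
    then obtain c' where c': "c = int p * c'" by blast
    have "a * (t - a) - (int p * b) * c' = 1" using 3 c' by (simp add: algebra_simps)
    moreover have "sgn c = sgn c'" using p by (simp add: c' sgn_mult)
    ultimately show ?thesis
      using conj_class_elliptic [of a t b c] conj_class_elliptic [of a t "int p * b" c'] 3
        pi_op_mat2 [OF p, of a b c' "t - a"] c' by simp
  qed
qed

section \<open>Powers and orders of torsion elements\<close>

lemma SL2Z_numeral_pows:
  assumes "A \<in> carrier SL2Z"
  shows "A [^]\<^bsub>SL2Z\<^esub> (2::nat) = A ** A" "A [^]\<^bsub>SL2Z\<^esub> (3::nat) = A ** A ** A"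
  using assms by (simp_all add: numeral_2_eq_2 numeral_3_eq_3)

text \<open>By Cayley-Hamilton the square is \<open>t A - 1\<close> and the cube is
  \<open>(t^2 - 1) A - t\<close>; in each case the coefficient of \<open>A\<close> vanishes.\<close>

lemma elliptic_pow:
  assumes A: "A = mat2 a b c (t - a)" "a * (t - a) - b * c = 1"
  shows "t = 0 \<Longrightarrow> A [^]\<^bsub>SL2Z\<^esub> (2::nat) = mat2 (- 1) 0 0 (- 1)"
    and "t = 1 \<Longrightarrow> A [^]\<^bsub>SL2Z\<^esub> (3::nat) = mat2 (- 1) 0 0 (- 1)"
    and "t = - 1 \<Longrightarrow> A [^]\<^bsub>SL2Z\<^esub> (3::nat) = mat2 1 0 0 1"
proof -
  have AG: "A \<in> carrier SL2Z" using A by simp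
  have AA: "A ** A = mat2 (t * a - 1) (t * b) (t * c) (t * (t - a) - 1)"
    using A by (simp add: algebra_simps)
  have AAA: "A ** A ** A = mat2 ((t\<^sup>2 - 1) * a - t) ((t\<^sup>2 - 1) * b) ((t\<^sup>2 - 1) * c) ((t\<^sup>2 - 1) * (t - a) - t)"
  proof -
    have "b * c = a * (t - a) - 1" using A(2) by simp
    then have "b * (c * t) = (a * (t - a) - 1) * t" by (metis mult.assoc)
    then show ?thesis unfolding AA unfolding A(1) by (simp add: algebra_simps power2_eq_square)
  qed
  show "t = 0 \<Longrightarrow> A [^]\<^bsub>SL2Z\<^esub> (2::nat) = mat2 (- 1) 0 0 (- 1)"
    "t = 1 \<Longrightarrow> A [^]\<^bsub>SL2Z\<^esub> (3::nat) = mat2 (- 1) 0 0 (- 1)"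
    "t = - 1 \<Longrightarrow> A [^]\<^bsub>SL2Z\<^esub> (3::nat) = mat2 1 0 0 1"
    unfolding SL2Z_numeral_pows [OF AG] AAA unfolding AA by simp_all
qed

lemma uminus_one_SL2Z_sq: "mat2 (- 1) 0 0 (- 1) [^]\<^bsub>SL2Z\<^esub> (2::nat) = \<one>\<^bsub>SL2Z\<^esub>"
  by (simp add: SL2Z_numeral_pows)

text \<open>The scalar powers from \<open>elliptic_pow\<close> make the order divide 4, 6 or 3.
  Smaller divisors are excluded because \<open>-1\<close> is not the identity and because
  \<open>c\<close> is nonzero.\<close>

lemma ord_elliptic:
  assumes A: "A = mat2 a b c (t - a)" "a * (t - a) - b * c = 1" and t: "\<bar>t\<bar> \<le> 1"
  shows "SL2Z.ord A = (if t = 0 then 4 else if t = 1 then 6 else 3)"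
proof -
  have AG: "A \<in> carrier SL2Z" using A by simp
  have c: "c \<noteq> 0" using elliptic_offdiag_neg(2) [OF A(2) t] by auto
  note dvd = SL2Z.pow_eq_id [OF AG, symmetric]
  note pow = elliptic_pow [OF A]
  have pow_mult: "A [^]\<^bsub>SL2Z\<^esub> (m * 2) = \<one>\<^bsub>SL2Z\<^esub>"
    if "A [^]\<^bsub>SL2Z\<^esub> m = mat2 (- 1) 0 0 (- 1)" for m :: nat
    using SL2Z.nat_pow_pow [OF AG, of m 2] that uminus_one_SL2Z_sq by simp
  consider "t = 0" | "t = 1" | "t = - 1" using t by linarith
  then show ?thesis
  proof cases
    case 1
    have "SL2Z.ord A dvd 4" using pow_mult [OF pow(1) [OF 1]] dvd by simp
    moreover have "\<not> SL2Z.ord A dvd 2" using dvd pow(1) [OF 1] by simp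
    ultimately have "SL2Z.ord A \<in> {d. d dvd 4} - {d. d dvd 2}" by simp
    moreover have "d = 4" if "d dvd 4" "\<not> d dvd 2" for d :: nat
    proof -
      have "d \<le> 4" using that by (auto dest: dvd_imp_le)
      then have "d = 0 \<or> d = 1 \<or> d = 2 \<or> d = 3 \<or> d = 4" by linarith
      then show ?thesis using that by auto
    qed
    ultimately show ?thesis using 1 by auto
  next
    case 2
    have "SL2Z.ord A dvd 6" using pow_mult [OF pow(2) [OF 2]] dvd by simp
    moreover have "\<not> SL2Z.ord A dvd 3" using dvd pow(2) [OF 2] by simp
    moreover have "\<not> SL2Z.ord A dvd 2"
      using dvd [of 2] SL2Z_numeral_pows(1) [OF AG] A 2 c by (simp add: algebra_simps)
    moreover have "d = 6" if "d dvd 6" "\<not> d dvd 3" "\<not> d dvd 2" for d :: nat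
    proof -
      have "d \<le> 6" using that by (auto dest: dvd_imp_le)
      then have "d = 0 \<or> d = 1 \<or> d = 2 \<or> d = 3 \<or> d = 4 \<or> d = 5 \<or> d = 6" by linarith
      then show ?thesis using that by auto
    qed
    ultimately show ?thesis using 2 by auto
  next
    case 3
    have "SL2Z.ord A dvd 3" using pow(3) [OF 3] dvd by simp
    moreover have "SL2Z.ord A \<noteq> 1" using SL2Z.ord_eq_1 [OF AG] A(1) c by simp
    moreover have "d = 3" if "d dvd 3" "d \<noteq> 1" for d :: nat
    proof -
      have "d \<le> 3" using that by (auto dest: dvd_imp_le)
      then have "d = 0 \<or> d = 1 \<or> d = 2 \<or> d = 3" by linarith
      then show ?thesis using that by auto
    qed
    ultimately show ?thesis using 3 by auto
  qed
qed

section \<open>The Hecke operators on torsion classes\<close>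

lemma torsion_class_rep:
  assumes "\<gamma> \<in> torsion_classes SL2Z"
  obtains n :: nat where "class_rep \<gamma> \<in> carrier SL2Z" "conj_class SL2Z (class_rep \<gamma>) = \<gamma>"
    "0 < n" "class_rep \<gamma> [^]\<^bsub>SL2Z\<^esub> n = \<one>\<^bsub>SL2Z\<^esub>"
proof -
  obtain b and n :: nat where b: "\<gamma> = conj_class SL2Z b" "b \<in> carrier SL2Z"
      and n: "0 < n" "b [^]\<^bsub>SL2Z\<^esub> n = \<one>\<^bsub>SL2Z\<^esub>"
    using assms unfolding torsion_classes_def by blast
  obtain h where h: "h \<in> carrier SL2Z"
    "class_rep \<gamma> = h \<otimes>\<^bsub>SL2Z\<^esub> b \<otimes>\<^bsub>SL2Z\<^esub> inv\<^bsub>SL2Z\<^esub> h"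
    using SL2Z.class_rep_conj_class [OF b(2)] b(1) by metis
  show ?thesis
  proof (rule that [OF _ _ n(1)])
    show "class_rep \<gamma> \<in> carrier SL2Z"
      unfolding h(2) using h(1) b(2) by (intro SL2Z.m_closed SL2Z.inv_closed)
    show "conj_class SL2Z (class_rep \<gamma>) = \<gamma>"
      unfolding h(2) using SL2Z.conj_class_conj [OF b(2) h(1)] b(1) by simp
    show "class_rep \<gamma> [^]\<^bsub>SL2Z\<^esub> n = \<one>\<^bsub>SL2Z\<^esub>"
      unfolding h(2) SL2Z.conj_nat_pow [OF b(2) h(1), symmetric] n(2)
      using SL2Z.r_one [OF h(1)] SL2Z.r_inv [OF h(1)] by simp
  qed
qed

lemma scalar_conj:
  assumes z: "z = mat2 1 0 0 1 \<or> z = mat2 (- 1) 0 0 (- 1)" and g: "g \<in> carrier SL2Z"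
  shows "g \<otimes>\<^bsub>SL2Z\<^esub> z \<otimes>\<^bsub>SL2Z\<^esub> inv\<^bsub>SL2Z\<^esub> g = z"
proof -
  obtain a b c d where "g = mat2 a b c d" "a * d - b * c = 1" using g by (rule SL2Z_E)
  then show ?thesis using z by (auto simp: algebra_simps)
qed

text \<open>Both pushforwards are instances of \<open>pushforward_pullback\<close> and give the same
  sum \<open>S\<close>. A scalar \<open>m\<close>-th power is central and lies in
  \<open>Gamma0 p\<close>, so \<open>sum_double_cosets\<close> evaluates \<open>S\<close>.\<close>

lemma hecke_torsion:
  assumes p: "prime p" and \<gamma>: "\<gamma> \<in> torsion_classes SL2Z"
  shows "hecke_T p (frag_of \<gamma>) = frag_of \<gamma> + hecke_e p (frag_of \<gamma>)"
    and "prime m \<Longrightarrow>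
      class_rep \<gamma> [^]\<^bsub>SL2Z\<^esub> m = mat2 1 0 0 1 \<or> class_rep \<gamma> [^]\<^bsub>SL2Z\<^esub> m = mat2 (- 1) 0 0 (- 1) \<Longrightarrow>
      \<exists>N. card (fixed_rcosets SL2Z (Gamma0 p) (class_rep \<gamma>)) + m * N = p + 1 \<and>
        hecke_T p (frag_of \<gamma>) =
          frag_cmul (int (card (fixed_rcosets SL2Z (Gamma0 p) (class_rep \<gamma>)))) (frag_of \<gamma>)
          + frag_cmul (int N) (frag_of (class_pow SL2Z \<gamma> m))"
proof -
  let ?a = "class_rep \<gamma>" and ?D = "double_cosets SL2Z (Gamma0 p) (class_rep \<gamma>)"
  obtain n :: nat where a: "?a \<in> carrier SL2Z" "conj_class SL2Z ?a = \<gamma>"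
    and tor: "0 < n" "?a [^]\<^bsub>SL2Z\<^esub> n = \<one>\<^bsub>SL2Z\<^esub>"
    using torsion_class_rep [OF \<gamma>] by blast
  note fin = card_rcosets_Gamma0(1) [OF p]
  define S where "S = (\<Sum>s\<in>?D. frag_of (conj_class SL2Z
    (?a [^]\<^bsub>SL2Z\<^esub> return_time SL2Z (Gamma0 p) ?a (SOME g. g \<in> s))))"
  have T: "hecke_T p (frag_of \<gamma>) = S"
    unfolding hecke_T_def S_def
    by (rule SL2Z.pushforward_pullback [OF subgroup_Gamma0 a(1) tor fin])
      (rule conj_class_pi_op [OF prime_gt_0_nat [OF p] _ tor(1)])
  moreover have "pushforward SL2Z (\<lambda>A. A) (pullback SL2Z (Gamma0 p) (frag_of \<gamma>)) = S"
    unfolding S_def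
    by (rule SL2Z.pushforward_pullback [OF subgroup_Gamma0 a(1) tor fin]) (rule refl)
  ultimately show "hecke_T p (frag_of \<gamma>) = frag_of \<gamma> + hecke_e p (frag_of \<gamma>)"
    by (simp add: hecke_e_def)
  have r: "(SOME g. g \<in> s) \<in> s" if "s \<in> ?D" for s
    by (rule someI_ex) (use SL2Z.double_coset_nonempty [OF subgroup_Gamma0 a(1) that] in blast)
  assume m: "prime m"
    and am: "?a [^]\<^bsub>SL2Z\<^esub> m = mat2 1 0 0 1 \<or> ?a [^]\<^bsub>SL2Z\<^esub> m = mat2 (- 1) 0 0 (- 1)"
  have "g \<otimes>\<^bsub>SL2Z\<^esub> ?a [^]\<^bsub>SL2Z\<^esub> m \<otimes>\<^bsub>SL2Z\<^esub> inv\<^bsub>SL2Z\<^esub> g \<in> Gamma0 p"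
    if "g \<in> carrier SL2Z" for g
    unfolding scalar_conj [OF am that] using am by auto
  from SL2Z.sum_double_cosets [OF subgroup_Gamma0 a(1) tor fin r m this,
      where f = "\<lambda>k. frag_of (conj_class SL2Z (?a [^]\<^bsub>SL2Z\<^esub> k))"]
  obtain N where N: "card (fixed_rcosets SL2Z (Gamma0 p) ?a) + m * N = card (rcosets\<^bsub>SL2Z\<^esub> Gamma0 p)"
    and S: "S = frag_cmul (int (card (fixed_rcosets SL2Z (Gamma0 p) ?a)))
        (frag_of (conj_class SL2Z (?a [^]\<^bsub>SL2Z\<^esub> (1::nat))))
      + frag_cmul (int N) (frag_of (conj_class SL2Z (?a [^]\<^bsub>SL2Z\<^esub> m)))"
    unfolding S_def by blast
  have "?a [^]\<^bsub>SL2Z\<^esub> (1::nat) = ?a" by (rule SL2Z.nat_pow_eone [OF a(1)])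
  then show "\<exists>N. card (fixed_rcosets SL2Z (Gamma0 p) ?a) + m * N = p + 1 \<and>
      hecke_T p (frag_of \<gamma>) = frag_cmul (int (card (fixed_rcosets SL2Z (Gamma0 p) ?a))) (frag_of \<gamma>)
        + frag_cmul (int N) (frag_of (class_pow SL2Z \<gamma> m))"
    using N S by (intro exI [of _ N]) (simp add: T class_pow_def a(2) card_rcosets_Gamma0(2) [OF p])
qed

text \<open>The count is made on the normal form. For nonzero \<open>t\<close> the product
  \<open>sgn c * t\<close> is again a sign, and both signs give the same number of roots.\<close>

lemma card_fixed_rcosets_elliptic_class:
  assumes p: "prime p"
    and A: "A = mat2 a b c (t - a)" "a * (t - a) - b * c = 1" and t: "\<bar>t\<bar> \<le> 1"
  shows "card (fixed_rcosets SL2Z (Gamma0 p) A) =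
    (if t = 0 then if p = 2 then 1 else if [p = 1] (mod 4) then 2 else 0
     else if p = 3 then 1 else if [p = 1] (mod 3) then 2 else 0)"
proof -
  let ?s = "sgn c"
  have "c \<noteq> 0" using elliptic_offdiag_neg(2) [OF A(2) t] by auto
  then have s: "?s = 1 \<or> ?s = - 1" by (simp add: sgn_if)
  have AG: "A \<in> carrier SL2Z" using A by simp
  have "A \<in> conj_class SL2Z (elliptic ?s t)"
    using conj_class_elliptic [OF A(2) t] SL2Z.conj_class_self [OF AG] A(1) by simp
  then obtain h where h: "h \<in> carrier SL2Z"
    "A = h \<otimes>\<^bsub>SL2Z\<^esub> elliptic ?s t \<otimes>\<^bsub>SL2Z\<^esub> inv\<^bsub>SL2Z\<^esub> h"
    by (auto simp: conj_class_def)
  have E: "elliptic ?s t \<in> carrier SL2Z" using s by (auto simp: elliptic_def)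
  have "card (fixed_rcosets SL2Z (Gamma0 p) A) =
      card {j \<in> {0..<int p}. int p dvd j\<^sup>2 - ?s * t * j + 1}"
    unfolding h(2) SL2Z.card_fixed_rcosets_conj [OF subgroup_Gamma0 E h(1)]
    by (rule card_fixed_rcosets_elliptic [OF p s])
  moreover have "t = 0 \<or> ?s * t = 1 \<or> ?s * t = - 1" using t s by auto
  ultimately show ?thesis
    using card_roots_order_4 [OF p] card_roots_order_3_6 [OF p, of "?s * t"] by auto
qed

theorem proposition10p10:
  fixes p :: nat and \<gamma> :: "(int^2^2) set"
  assumes "prime p"
    and "\<gamma> \<in> torsion_classes SL2Z"
  shows "(hecke_T p (frag_of \<gamma>) = frag_of \<gamma> + hecke_e p (frag_of \<gamma>)) \<and>
    (\<gamma> = conj_class SL2Z (mat 1) \<or> \<gamma> = conj_class SL2Z (- mat 1) \<or>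
         class_ord SL2Z \<gamma> = 4 \<or> class_ord SL2Z \<gamma> \<in> {3, 6}) \<and>
    ((\<gamma> = conj_class SL2Z (mat 1) \<or> \<gamma> = conj_class SL2Z (- mat 1)) \<longrightarrow>
         hecke_T p (frag_of \<gamma>) = frag_cmul (int p + 1) (frag_of \<gamma>)) \<and>
    (class_ord SL2Z \<gamma> = 4 \<and> p = 2 \<longrightarrow>
         hecke_T p (frag_of \<gamma>) = frag_of (class_pow SL2Z \<gamma> 2) + frag_of \<gamma>) \<and>
    (class_ord SL2Z \<gamma> = 4 \<and> [p = 1] (mod 4) \<longrightarrow>
         hecke_T p (frag_of \<gamma>) =
           frag_cmul 2 (frag_of \<gamma>) + frag_cmul ((int p - 1) div 2) (frag_of (class_pow SL2Z \<gamma> 2))) \<and>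
    (class_ord SL2Z \<gamma> = 4 \<and> [p = 3] (mod 4) \<longrightarrow>
         hecke_T p (frag_of \<gamma>) = frag_cmul ((int p + 1) div 2) (frag_of (class_pow SL2Z \<gamma> 2))) \<and>
    (class_ord SL2Z \<gamma> \<in> {3, 6} \<and> p = 3 \<longrightarrow>
         hecke_T p (frag_of \<gamma>) = frag_of \<gamma> + frag_of (class_pow SL2Z \<gamma> 3)) \<and>
    (class_ord SL2Z \<gamma> \<in> {3, 6} \<and> [p = 1] (mod 3) \<longrightarrow>
         hecke_T p (frag_of \<gamma>) =
           frag_cmul 2 (frag_of \<gamma>) + frag_cmul ((int p - 1) div 3) (frag_of (class_pow SL2Z \<gamma> 3))) \<and>
    (class_ord SL2Z \<gamma> \<in> {3, 6} \<and> [int p = - 1] (mod 3) \<longrightarrow>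
         hecke_T p (frag_of \<gamma>) = frag_cmul ((int p + 1) div 3) (frag_of (class_pow SL2Z \<gamma> 3)))"
proof -
  note p = assms(1) and T_eq = hecke_torsion(1) [OF assms]
  let ?a = "class_rep \<gamma>" and ?F = "card (fixed_rcosets SL2Z (Gamma0 p) (class_rep \<gamma>))"
  obtain n :: nat where a: "?a \<in> carrier SL2Z" "conj_class SL2Z ?a = \<gamma>"
    and tor: "0 < n" "?a [^]\<^bsub>SL2Z\<^esub> n = \<one>\<^bsub>SL2Z\<^esub>"
    using torsion_class_rep [OF assms(2)] by blast
  \<comment> \<open>The class of a central element is a singleton, so its chosen representative is
    that element.\<close>
  have scalar_rep: "?a = z"
    if z: "z = mat2 1 0 0 1 \<or> z = mat2 (- 1) 0 0 (- 1)" and "\<gamma> = conj_class SL2Z z" for z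
  proof -
    have "z \<in> carrier SL2Z" using z by auto
    then obtain h where "h \<in> carrier SL2Z"
      "class_rep (conj_class SL2Z z) = h \<otimes>\<^bsub>SL2Z\<^esub> z \<otimes>\<^bsub>SL2Z\<^esub> inv\<^bsub>SL2Z\<^esub> h"
      by (rule SL2Z.class_rep_conj_class)
    then show ?thesis using scalar_conj [OF z] that(2) by simp
  qed
  consider "?a = mat2 1 0 0 1 \<or> ?a = mat2 (- 1) 0 0 (- 1)"
    | a b c t where "?a = mat2 a b c (t - a)" "a * (t - a) - b * c = 1" "\<bar>t\<bar> \<le> 1"
    using SL2Z_torsion_cases [OF a(1) tor] by metis
  then show ?thesis
  proof cases
    case 1
    have sq: "?a [^]\<^bsub>SL2Z\<^esub> (2::nat) = mat2 1 0 0 1"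
      unfolding SL2Z_numeral_pows [OF a(1)] using 1 by auto
    then have "SL2Z.ord ?a dvd 2" using SL2Z.pow_eq_id [OF a(1), of 2] by simp
    then have "class_ord SL2Z \<gamma> \<le> 2" unfolding class_ord_def by (auto dest: dvd_imp_le)
    then have ord: "class_ord SL2Z \<gamma> \<noteq> 4" "class_ord SL2Z \<gamma> \<notin> {3, 6}" by auto
    \<comment> \<open>With \<open>m = 2\<close>: a scalar fixes all \<open>p + 1\<close> right
      cosets, so \<open>N\<close> will be 0.\<close>
    obtain N where N: "?F + 2 * N = p + 1"
      and T: "hecke_T p (frag_of \<gamma>) = frag_cmul (int ?F) (frag_of \<gamma>)
        + frag_cmul (int N) (frag_of (class_pow SL2Z \<gamma> 2))"
      using hecke_torsion(2) [OF assms two_is_prime_nat] sq by blast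
    have "C #>\<^bsub>SL2Z\<^esub> ?a = C" if C: "C \<in> rcosets\<^bsub>SL2Z\<^esub> Gamma0 p" for C
    proof -
      obtain g where g: "g \<in> carrier SL2Z" "C = Gamma0 p #>\<^bsub>SL2Z\<^esub> g"
        using C unfolding RCOSETS_def by auto
      have "?a \<in> Gamma0 p" using 1 by auto
      then show ?thesis
        unfolding g(2) SL2Z.r_coset_fixed_iff [OF subgroup_Gamma0 a(1) g(1)] scalar_conj [OF 1 g(1)] .
    qed
    then have "fixed_rcosets SL2Z (Gamma0 p) ?a = rcosets\<^bsub>SL2Z\<^esub> Gamma0 p"
      by (auto simp: fixed_rcosets_def)
    then have F: "?F = p + 1" using card_rcosets_Gamma0(2) [OF p] by simp
    then have "N = 0" using N by simp
    then have "hecke_T p (frag_of \<gamma>) = frag_cmul (int p + 1) (frag_of \<gamma>)"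
      using T F by (simp add: add.commute)
    moreover have "\<gamma> = conj_class SL2Z (mat 1) \<or> \<gamma> = conj_class SL2Z (- mat 1)"
      unfolding uminus_mat_1_eq_mat2 unfolding mat_1_eq_mat2 using 1 a(2) by metis
    ultimately show ?thesis using T_eq ord by blast
  next
    case (2 a b c t)
    note A = 2
    have "c \<noteq> 0" using elliptic_offdiag_neg(2) [OF A(2,3)] by auto
    then have not_scalar: "\<gamma> \<noteq> conj_class SL2Z (mat 1)" "\<gamma> \<noteq> conj_class SL2Z (- mat 1)"
      using scalar_rep A(1) unfolding uminus_mat_1_eq_mat2 unfolding mat_1_eq_mat2 by (metis mat2_eq_iff)+
    have ord: "class_ord SL2Z \<gamma> = (if t = 0 then 4 else if t = 1 then 6 else 3)"
      unfolding class_ord_def using ord_elliptic [OF A] .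
    note F = card_fixed_rcosets_elliptic_class [OF p A]
    note pow = elliptic_pow [OF A(1,2)]
    show ?thesis
    proof (cases "t = 0")
      case True
      obtain N where N: "?F + 2 * N = p + 1"
        and T: "hecke_T p (frag_of \<gamma>) = frag_cmul (int ?F) (frag_of \<gamma>)
          + frag_cmul (int N) (frag_of (class_pow SL2Z \<gamma> 2))"
        using hecke_torsion(2) [OF assms two_is_prime_nat] pow(1) [OF True] by blast
      \<comment> \<open>In each residue class the number of fixed points is known, and
        \<open>?F + 2 * N = p + 1\<close> then yields \<open>N\<close>.\<close>
      have "?F = 1 \<and> int N = 1" if "p = 2"
        using that F N True by simp
      moreover have "?F = 2 \<and> int N = (int p - 1) div 2" if "[p = 1] (mod 4)"
      proof -
        have "p \<noteq> 2" using that by (auto simp: cong_def)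
        then show ?thesis using that F N True by simp
      qed
      moreover have "?F = 0 \<and> int N = (int p + 1) div 2" if "[p = 3] (mod 4)"
      proof -
        have "p \<noteq> 2" "\<not> [p = 1] (mod 4)" using that by (auto simp: cong_def)
        then show ?thesis using F N True by simp
      qed
      ultimately have
        "p = 2 \<Longrightarrow> hecke_T p (frag_of \<gamma>) = frag_of (class_pow SL2Z \<gamma> 2) + frag_of \<gamma>"
        "[p = 1] (mod 4) \<Longrightarrow> hecke_T p (frag_of \<gamma>) =
          frag_cmul 2 (frag_of \<gamma>) + frag_cmul ((int p - 1) div 2) (frag_of (class_pow SL2Z \<gamma> 2))"
        "[p = 3] (mod 4) \<Longrightarrow> hecke_T p (frag_of \<gamma>) =
          frag_cmul ((int p + 1) div 2) (frag_of (class_pow SL2Z \<gamma> 2))"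
        unfolding T by (simp_all add: add.commute)
      moreover have "class_ord SL2Z \<gamma> = 4" "class_ord SL2Z \<gamma> \<notin> {3, 6}" using ord True by simp_all
      ultimately show ?thesis using T_eq not_scalar by blast
    next
      case False
      then have t: "t = 1 \<or> t = - 1" using A(3) by linarith
      \<comment> \<open>The exponent 3 serves both orders: the cube is \<open>-1\<close> for
        \<open>t = 1\<close> and the identity for \<open>t = -1\<close>.\<close>
      have "prime (3::nat)" by simp
      then obtain N where N: "?F + 3 * N = p + 1"
        and T: "hecke_T p (frag_of \<gamma>) = frag_cmul (int ?F) (frag_of \<gamma>)
          + frag_cmul (int N) (frag_of (class_pow SL2Z \<gamma> 3))"
        using hecke_torsion(2) [OF assms, of 3] pow(2,3) t by blast
      have "?F = 1 \<and> int N = 1" if "p = 3"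
        using that F N False by simp
      moreover have "?F = 2 \<and> int N = (int p - 1) div 3" if "[p = 1] (mod 3)"
      proof -
        have "p \<noteq> 3" using that by (auto simp: cong_def)
        then show ?thesis using that F N False by simp
      qed
      moreover have "?F = 0 \<and> int N = (int p + 1) div 3" if "[int p = - 1] (mod 3)"
      proof -
        have "int p mod 3 = 2" using that by (simp add: cong_def)
        then have "p mod 3 = 2" by presburger
        then have "p \<noteq> 3" "\<not> [p = 1] (mod 3)" by (auto simp: cong_def)
        then show ?thesis using F N False by simp
      qed
      ultimately have
        "p = 3 \<Longrightarrow> hecke_T p (frag_of \<gamma>) = frag_of \<gamma> + frag_of (class_pow SL2Z \<gamma> 3)"
        "[p = 1] (mod 3) \<Longrightarrow> hecke_T p (frag_of \<gamma>) =
          frag_cmul 2 (frag_of \<gamma>) + frag_cmul ((int p - 1) div 3) (frag_of (class_pow SL2Z \<gamma> 3))"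
        "[int p = - 1] (mod 3) \<Longrightarrow> hecke_T p (frag_of \<gamma>) =
          frag_cmul ((int p + 1) div 3) (frag_of (class_pow SL2Z \<gamma> 3))"
        unfolding T by simp_all
      moreover have "class_ord SL2Z \<gamma> \<in> {3, 6}" "class_ord SL2Z \<gamma> \<noteq> 4" using ord t by auto
      ultimately show ?thesis using T_eq not_scalar by blast
    qed
  qed
qed

end
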